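(* Let $q$ be a prime power and for $n\ge1$ let $\mu_q(n)$ be the number of elements of $\mathbb{F}_{q^n}$ that are normal over $\mathbb{F}_q$, divided by $q^n$. For each positive integer $t$, let $L_t$ be the least common multiple of the numbers $q^i-1$, $1\le i\le t$, and set $A_t=\frac{1}{L_t}\sum_{r\mid L_t}\mu_q(r)\varphi\!\left(\frac{L_t}{r}\right)$. Then $\{A_t\}_{t\ge1}$ converges to a limit $\overline{\mu}_q>0$, and $$\overline{\mu}_q=\lim_{x\to+\infty}\frac{1}{x}\sum_{n\le x}\mu_q(n).$$ Moreover, $\lim_{q\to+\infty}\overline{\mu}_q=1$.
   Context: $\varphi$ is Euler's totient function. An element $\beta\in\mathbb{F}_{q^n}$ is normal over $\mathbb{F}_q$ if $\{\beta,\beta^q,\ldots,\beta^{q^{n-1}}\}$ is a basis of $\mathbb{F}_{q^n}$ as an $\mathbb{F}_q$-vector space. *)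

theory Defs
  imports
    Complex_Main
    "HOL-Algebra.Algebraic_Closure"
    "HOL-Number_Theory.Number_Theory"
begin

text \<open>
  For a prime power \<open>q = p ^ k\<close>, \<open>GF q\<close> is the field with \<open>q\<close> elements, realised as the set of roots
  of \<open>X ^ q - X\<close> in the algebraic closure of \<open>\<int>/p\<int>\<close>. For fixed \<open>p\<close> all these fields live in the
  same closure, so \<open>carrier (GF q)\<close> is literally a subfield of \<open>GF (q ^ n)\<close> whenever \<open>n \<ge> 1\<close>.
\<close>

definition GF :: "nat \<Rightarrow> ((int list \<times> nat) multiset \<Rightarrow> int) ring" where
  "GF q = (let \<Omega> = field.alg_closure (residue_ring (int (aprimedivisor q)))
           in \<Omega>\<lparr>carrier := {x \<in> carrier \<Omega>. x [^]\<^bsub>\<Omega>\<^esub> q = x}\<rparr>)"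

text \<open>
  The conjugates are kept as the list \<open>\<beta>, \<beta> ^ q, \<dots>, \<beta> ^ (q ^ (n - 1))\<close>. Reading them as a set
  instead makes no difference: a basis of \<open>GF (q ^ n)\<close> over \<open>GF q\<close> has \<open>n\<close> elements, so the set
  can only be a basis if the list has no repetitions.
\<close>

definition is_normal :: "nat \<Rightarrow> nat \<Rightarrow> ((int list \<times> nat) multiset \<Rightarrow> int) \<Rightarrow> bool" where
  "is_normal q n \<beta> \<longleftrightarrow>
     \<beta> \<in> carrier (GF (q ^ n)) \<and>
     (let conjugates = map (\<lambda>i. \<beta> [^]\<^bsub>GF (q ^ n)\<^esub> (q ^ i)) [0..<n] in
        ring.independent (GF (q ^ n)) (carrier (GF q)) conjugates \<and>
        ring.Span (GF (q ^ n)) (carrier (GF q)) conjugates = carrier (GF (q ^ n)))"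

definition normal_density :: "nat \<Rightarrow> nat \<Rightarrow> real" where
  "normal_density q n = real (card {\<beta>. is_normal q n \<beta>}) / real (q ^ n)"

definition L_seq :: "nat \<Rightarrow> nat \<Rightarrow> nat" where
  "L_seq q t = Lcm ((\<lambda>i. q ^ i - 1) ` {1..t})"

definition A_seq :: "nat \<Rightarrow> nat \<Rightarrow> real" where
  "A_seq q t = (1 / real (L_seq q t)) *
           (\<Sum>r | r dvd L_seq q t. normal_density q r * real (totient (L_seq q t div r)))"

definition mean_density :: "nat \<Rightarrow> real" where
  "mean_density q = lim (A_seq q)"

end

theory Submission
  imports Defs "HOL-Library.Disjoint_Sets" "HOL-Library.Discrete_Functions"
begin

text \<open>
  The density is multiplicative over divisors: \<open>\<mu>\<^sub>q(n)\<close> is the product of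
  \<open>f(e) = (1 - q\<^sup>-\<^sup>d)\<close> raised to \<open>\<phi>(e) / d\<close>, with \<open>d = ord e q\<close>, over the divisors \<open>e\<close> of \<open>n\<close> that are
  coprime to \<open>q\<close>. An element of \<open>GF (q ^ n)\<close> is normal iff it lies in no proper subspace stable
  under \<open>\<sigma> = (x \<mapsto> x ^ q)\<close>. If \<open>n\<close> is coprime to \<open>q\<close> and \<open>\<zeta>\<close> is a primitive \<open>n\<close>-th root of unity, this
  means that no discrete Fourier coefficient \<open>\<Sum>i<n. \<zeta> ^ (i * j) * \<beta> ^ (q ^ i)\<close> vanishes; these
  coefficients may be prescribed independently on the orbits of multiplication by \<open>q\<close> on \<open>\<int>/n\<close>, an
  orbit of size \<open>d\<close> allowing \<open>q ^ d\<close> values. If \<open>p\<close> divides \<open>n = p * m\<close>, an element is normal iff its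
  trace to \<open>GF (q ^ m)\<close> is, so that \<open>\<mu>\<^sub>q(p * m) = \<mu>\<^sub>q(m)\<close>.

  Hence \<open>A\<^sub>t\<close> is the mean over a period of \<open>m \<mapsto> \<mu>\<^sub>q(gcd m L\<^sub>t)\<close>, which decreases in \<open>t\<close>. Every \<open>e \<le> t\<close>
  coprime to \<open>q\<close> divides \<open>L\<^sub>t\<close>, so passing from \<open>\<mu>\<^sub>q(m)\<close> to \<open>\<mu>\<^sub>q(gcd m L\<^sub>t)\<close> changes the mean by at
  most the sum of \<open>- ln (f(e)) / e\<close> over \<open>e > t\<close>. The full sum \<open>W\<close> of this series is
  \<open>O(q\<^sup>-\<^sup>1\<^sup>/\<^sup>2)\<close>, and convexity of \<open>exp\<close> bounds the limit below by \<open>exp (- W)\<close>.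
\<close>

section \<open>Additive operators and the freshman identity in characteristic
  \<open>p\<close>\<close>

lemma (in abelian_group) additive_add_pow:
  assumes "\<And>x. x \<in> carrier G \<Longrightarrow> A x \<in> carrier G"
    and "\<And>x y. x \<in> carrier G \<Longrightarrow> y \<in> carrier G \<Longrightarrow> A (x \<oplus> y) = A x \<oplus> A y"
    and "x \<in> carrier G"
  shows "A \<zero> = \<zero>" and "A ([(k::nat)] \<cdot> x) = [k] \<cdot> A x"
proof -
  have "A \<zero> \<oplus> A \<zero> = A \<zero>" using assms(2)[of \<zero> \<zero>] by simp
  then show z: "A \<zero> = \<zero>" using assms(1)[of \<zero>] by (metis add.l_cancel_one' zero_closed)
  show "A ([(k::nat)] \<cdot> x) = [k] \<cdot> A x"
    using assms z by (induction k) (simp_all add: add.nat_pow_Suc)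
qed

lemma (in abelian_group) additive_finsum:
  assumes "\<And>x. x \<in> carrier G \<Longrightarrow> A x \<in> carrier G"
    and "\<And>x y. x \<in> carrier G \<Longrightarrow> y \<in> carrier G \<Longrightarrow> A (x \<oplus> y) = A x \<oplus> A y"
    and "f \<in> I \<rightarrow> carrier G"
  shows "A (finsum G f I) = finsum G (\<lambda>i. A (f i)) I"
  using assms(3)
proof (induction I rule: infinite_finite_induct)
  case (infinite I)
  then show ?case using additive_add_pow(1)[OF assms(1,2) zero_closed] by simp
next
  case empty
  then show ?case using additive_add_pow(1)[OF assms(1,2) zero_closed] by simp
next
  case (insert i I)
  then show ?case using assms(1,2) by (simp add: Pi_def)
qed

text \<open>Phrased for commuting operators instead of ring elements so that it serves both for
  multiplications in a ring (\<open>freshman\<close>) and for the operators \<open>N m\<close> built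
  from Frobenius (\<open>N_pow_p\<close>).\<close>

lemma (in abelian_group) commuting_binomial:
  fixes n :: nat
  assumes A: "\<And>x. x \<in> carrier G \<Longrightarrow> A x \<in> carrier G"
    "\<And>x y. x \<in> carrier G \<Longrightarrow> y \<in> carrier G \<Longrightarrow> A (x \<oplus> y) = A x \<oplus> A y"
    and B: "\<And>x. x \<in> carrier G \<Longrightarrow> B x \<in> carrier G"
    "\<And>x y. x \<in> carrier G \<Longrightarrow> y \<in> carrier G \<Longrightarrow> B (x \<oplus> y) = B x \<oplus> B y"
    and comm: "\<And>x. x \<in> carrier G \<Longrightarrow> A (B x) = B (A x)"
    and x: "x \<in> carrier G"
  shows "((\<lambda>x. A x \<oplus> B x) ^^ n) x = (\<Oplus>i\<in>{..n}. [(n choose i)] \<cdot> ((A ^^ i) ((B ^^ (n - i)) x)))"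
proof (induction n)
  case 0
  then show ?case using x by simp
next
  case (Suc n)
  have Ak: "(A ^^ i) y \<in> carrier G" if "y \<in> carrier G" for i y
    using that A by (induction i) auto
  have Bk: "(B ^^ i) y \<in> carrier G" if "y \<in> carrier G" for i y
    using that B by (induction i) auto
  have BAk: "B ((A ^^ i) y) = (A ^^ i) (B y)" if "y \<in> carrier G" for i y
    using that by (induction i) (simp_all add: comm[symmetric] Ak)
  define t where "t i = (A ^^ i) ((B ^^ (Suc n - i)) x)" for i
  have t: "t i \<in> carrier G" for i unfolding t_def using Ak Bk x by blast
  define S where "S = (\<Oplus>i\<in>{..n}. [(n choose i)] \<cdot> ((A ^^ i) ((B ^^ (n - i)) x)))"
  have AS: "A S = (\<Oplus>i\<in>{..n}. [(n choose i)] \<cdot> t (Suc i))"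
  proof -
    have "A S = (\<Oplus>i\<in>{..n}. A ([(n choose i)] \<cdot> ((A ^^ i) ((B ^^ (n - i)) x))))"
      unfolding S_def by (rule additive_finsum) (use A Ak Bk x in auto)
    also have "\<dots> = (\<Oplus>i\<in>{..n}. [(n choose i)] \<cdot> t (Suc i))"
      by (intro finsum_cong') (use t in \<open>auto simp: t_def A additive_add_pow(2)[OF A] Ak Bk x\<close>)
    finally show ?thesis .
  qed
  have BS: "B S = (\<Oplus>i\<in>{..n}. [(n choose i)] \<cdot> t i)"
  proof -
    have "B S = (\<Oplus>i\<in>{..n}. B ([(n choose i)] \<cdot> ((A ^^ i) ((B ^^ (n - i)) x))))"
      unfolding S_def by (rule additive_finsum) (use B Ak Bk x in auto)
    also have "\<dots> = (\<Oplus>i\<in>{..n}. [(n choose i)] \<cdot> t i)"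
      by (intro finsum_cong') (use t in \<open>auto simp: t_def B additive_add_pow(2)[OF B] Ak Bk BAk x Suc_diff_le\<close>)
    finally show ?thesis .
  qed
  \<comment> \<open>Pascal's rule. At \<open>i = 0\<close> the second coefficient must be set to 0,
    since truncated subtraction would make \<open>n choose (i - 1)\<close> equal to 1.\<close>
  have "(\<Oplus>i\<in>{..Suc n}. [(Suc n choose i)] \<cdot> t i)
      = (\<Oplus>i\<in>{..Suc n}. [(n choose i)] \<cdot> t i \<oplus> [(if i = 0 then 0 else n choose (i - 1))] \<cdot> t i)"
  proof (rule finsum_cong', simp_all add: t, goal_cases)
    case (1 i)
    then show ?case
      by (cases i) (auto simp: add.nat_pow_mult[OF t] add.commute)
  qed
  also have "\<dots> = (\<Oplus>i\<in>{..Suc n}. [(n choose i)] \<cdot> t i) \<oplus>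
      (\<Oplus>i\<in>{..Suc n}. [(if i = 0 then 0 else n choose (i - 1))] \<cdot> t i)"
    by (subst finsum_addf) (simp_all add: t)
  also have "(\<Oplus>i\<in>{..Suc n}. [(n choose i)] \<cdot> t i) = B S"
    by (subst finsum_Suc) (simp_all add: t BS binomial_eq_0)
  also have "(\<Oplus>i\<in>{..Suc n}. [(if i = 0 then 0 else n choose (i - 1))] \<cdot> t i) = A S"
    by (subst finsum_Suc2) (simp_all add: t AS)
  also have "B S \<oplus> A S = A S \<oplus> B S"
  proof -
    have "S \<in> carrier G" unfolding S_def using Ak Bk x by simp
    then show ?thesis using A B by (simp add: a_comm)
  qed
  finally have "A S \<oplus> B S = (\<Oplus>i\<in>{..Suc n}. [(Suc n choose i)] \<cdot> t i)" ..
  then show ?case unfolding funpow.simps o_apply Suc S_def[symmetric] t_def by simp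
qed

text \<open>\<open>p\<close> divides all the inner binomial coefficients, so only the two extreme
  terms survive. An abelian group has no unit, hence \<open>char\<close> is asked of every
  element.\<close>

lemma (in abelian_group) commuting_freshman:
  fixes p :: nat
  assumes A: "\<And>x. x \<in> carrier G \<Longrightarrow> A x \<in> carrier G"
    "\<And>x y. x \<in> carrier G \<Longrightarrow> y \<in> carrier G \<Longrightarrow> A (x \<oplus> y) = A x \<oplus> A y"
    and B: "\<And>x. x \<in> carrier G \<Longrightarrow> B x \<in> carrier G"
    "\<And>x y. x \<in> carrier G \<Longrightarrow> y \<in> carrier G \<Longrightarrow> B (x \<oplus> y) = B x \<oplus> B y"
    and comm: "\<And>x. x \<in> carrier G \<Longrightarrow> A (B x) = B (A x)"
    and x: "x \<in> carrier G"
    and p: "prime p" and char: "\<And>x. x \<in> carrier G \<Longrightarrow> [p] \<cdot> x = \<zero>"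
  shows "((\<lambda>x. A x \<oplus> B x) ^^ p) x = (A ^^ p) x \<oplus> (B ^^ p) x"
proof -
  have Ak: "(A ^^ i) y \<in> carrier G" if "y \<in> carrier G" for i y
    using that A by (induction i) auto
  have Bk: "(B ^^ i) y \<in> carrier G" if "y \<in> carrier G" for i y
    using that B by (induction i) auto
  define t where "t i = (A ^^ i) ((B ^^ (p - i)) x)" for i
  have t: "t i \<in> carrier G" for i unfolding t_def using Ak Bk x by blast
  have p0: "p > 0" using p by (simp add: prime_gt_0_nat)
  have "((\<lambda>x. A x \<oplus> B x) ^^ p) x = (\<Oplus>i\<in>{..p}. [(p choose i)] \<cdot> t i)"
    unfolding t_def by (rule commuting_binomial) (use assms in auto)
  also have "\<dots> = (\<Oplus>i\<in>{0, p}. [(p choose i)] \<cdot> t i)"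
  proof (rule add.finprod_mono_neutral_cong_right)
    fix i assume i: "i \<in> {..p} - {0, p}"
    then have "p dvd (p choose i)" using p by (intro dvd_choose_prime) auto
    then obtain k where "p choose i = p * k" by auto
    then show "[(p choose i)] \<cdot> t i = \<zero>"
      using char[OF t[of i]] add.nat_pow_pow[OF t[of i], of p k] add.nat_pow_pow[OF t[of i], of k p] by (simp add: mult.commute)
  qed (use t in auto)
  also have "\<dots> = t 0 \<oplus> t p" using p0 t by simp
  finally show ?thesis using p0 by (simp add: t_def a_comm Ak Bk x)
qed

text \<open>Multiplications by \<open>x\<close> and by \<open>y\<close> are commuting additive
  operators; evaluating their \<open>p\<close>-th powers at \<open>\<one>\<close> gives the case
  \<open>k = 1\<close>, which is then iterated.\<close>

lemma (in cring) freshman: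
  fixes p :: nat
  assumes p: "prime p" and char: "[p] \<cdot> \<one> = \<zero>" and x: "x \<in> carrier R" and y: "y \<in> carrier R"
  shows "(x \<oplus> y) [^] (p ^ k) = x [^] (p ^ k) \<oplus> y [^] (p ^ k)"
proof -
  have char': "[p] \<cdot> z = \<zero>" if "z \<in> carrier R" for z
    using add_pow_ldistr[of \<one> z p] char that by simp
  have one: "(x \<oplus> y) [^] p = x [^] p \<oplus> y [^] p" if x: "x \<in> carrier R" and y: "y \<in> carrier R" for x y
  proof -
    have *: "((\<lambda>z. a \<otimes> z) ^^ n) \<one> = a [^] n" if "a \<in> carrier R" for a and n :: nat
      using that by (induction n) (simp_all add: m_comm)
    have "((\<lambda>z. x \<otimes> z \<oplus> y \<otimes> z) ^^ p) \<one> = ((\<lambda>z. x \<otimes> z) ^^ p) \<one> \<oplus> ((\<lambda>z. y \<otimes> z) ^^ p) \<one>"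
      by (rule commuting_freshman) (use x y p char' in \<open>auto simp: r_distr m_lcomm\<close>)
    moreover have "((\<lambda>z. x \<otimes> z \<oplus> y \<otimes> z) ^^ n) \<one> = ((\<lambda>z. (x \<oplus> y) \<otimes> z) ^^ n) \<one>" for n
    proof (induction n)
      case (Suc n)
      have "((\<lambda>z. (x \<oplus> y) \<otimes> z) ^^ n) \<one> \<in> carrier R" using *[of "x \<oplus> y" n] x y by simp
      then show ?case using Suc x y by (simp add: l_distr)
    qed simp
    ultimately show ?thesis using * x y by simp
  qed
  show ?thesis
  proof (induction k)
    case (Suc k)
    have "z [^] (p ^ Suc k) = (z [^] (p ^ k)) [^] p" if "z \<in> carrier R" for z
      using that by (simp add: nat_pow_pow mult.commute)
    then show ?case using Suc one x y by simp
  qed (use x y in simp)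
qed

text \<open>With \<open>Q = p ^ k\<close>, the polynomial \<open>X ^ Q - X\<close> splits, so it
  suffices that its roots are simple. At a root \<open>a\<close> the freshman identity rewrites it
  in \<open>b = X - a\<close> as \<open>b ^ Q - b\<close>, which \<open>b ^ 2\<close> cannot
  divide.\<close>

lemma (in algebraically_closed) card_frobenius_fixed:
  fixes p k :: nat
  assumes p: "prime p" and char: "[p] \<cdot> \<one> = \<zero>" and k: "k > 0"
  shows "card {x \<in> carrier L. x [^] (p ^ k) = x} = p ^ k"
proof -
  let ?K = "carrier L"
  let ?R = "?K[X]"
  define Q where "Q = p ^ k"
  have Q: "Q > 1" using one_less_power[OF prime_gt_1_nat[OF p] k] by (simp add: Q_def)
  interpret UP: domain ?R using univ_poly_is_domain[OF carrier_is_subring] .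
  interpret C: ring_hom_ring "L\<lparr>carrier := ?K\<rparr>" ?R poly_of_const
    using canonical_embedding_ring_hom[OF carrier_is_subring] .
  have cadd: "poly_of_const (x \<oplus> y) = poly_of_const x \<oplus>\<^bsub>?R\<^esub> poly_of_const y"
    if "x \<in> ?K" "y \<in> ?K" for x y using C.hom_add[of x y] that by simp
  have cmul: "poly_of_const (x \<otimes> y) = poly_of_const x \<otimes>\<^bsub>?R\<^esub> poly_of_const y"
    if "x \<in> ?K" "y \<in> ?K" for x y using C.hom_mult[of x y] that by simp
  have c1: "poly_of_const \<one> = \<one>\<^bsub>?R\<^esub>" using C.hom_one by simp
  have c0: "poly_of_const \<zero> = \<zero>\<^bsub>?R\<^esub>" using C.hom_zero by simp
  have cc: "poly_of_const x \<in> carrier ?R" if "x \<in> ?K" for x using C.hom_closed that by simp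
  have cpow: "poly_of_const (x [^] n) = poly_of_const x [^]\<^bsub>?R\<^esub> n" if "x \<in> ?K" for x and n :: nat
    using that by (induction n) (simp_all add: c1 cmul)
  have cnat: "poly_of_const ([n] \<cdot> \<one>) = [n] \<cdot>\<^bsub>?R\<^esub> \<one>\<^bsub>?R\<^esub>" for n :: nat
    by (induction n) (simp_all add: c0 c1 cadd)
  have charUP: "[p] \<cdot>\<^bsub>?R\<^esub> \<one>\<^bsub>?R\<^esub> = \<zero>\<^bsub>?R\<^esub>" using cnat[of p] char c0 by simp
  have X: "X \<in> carrier ?R" using var_closed(1)[OF carrier_is_subring] .
  define f where "f = X [^]\<^bsub>?R\<^esub> Q \<ominus>\<^bsub>?R\<^esub> X"
  have f: "f \<in> carrier ?R" using X by (simp add: f_def)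
  have "degree f = Q"
  proof -
    have mX: "\<ominus>\<^bsub>?R\<^esub> X \<in> carrier ?R" using X by simp
    have XQ: "X [^]\<^bsub>?R\<^esub> Q = monom \<one> Q"
      using unitary_monom_eq_var_pow[OF carrier_is_subring] by simp
    have 1: "degree (X [^]\<^bsub>?R\<^esub> Q) = Q" unfolding XQ by (simp add: monom_def)
    have 2: "degree (\<ominus>\<^bsub>?R\<^esub> X) = 1"
      using univ_poly_a_inv_degree[OF carrier_is_subring X] by (simp add: var_def)
    have "degree (poly_add (X [^]\<^bsub>?R\<^esub> Q) (\<ominus>\<^bsub>?R\<^esub> X)) = max Q 1"
      using poly_add_degree_eq[OF carrier_is_subring, of "X [^]\<^bsub>?R\<^esub> Q" "\<ominus>\<^bsub>?R\<^esub> X"] 1 2 Q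
        UP.nat_pow_closed[OF X, of Q] mX by (auto simp: univ_poly_carrier)
    then show ?thesis using Q unfolding f_def a_minus_def univ_poly_add by simp
  qed
  then have f0: "f \<noteq> []" using Q by auto
  have ev: "eval f a = a [^] Q \<ominus> a" if a: "a \<in> ?K" for a
  proof -
    interpret E: ring_hom_ring ?R L "\<lambda>p. eval p a" using eval_ring_hom[OF carrier_is_subring a] .
    have pw: "eval (X [^]\<^bsub>?R\<^esub> n) a = a [^] n" for n :: nat
      using X by (induction n) (simp_all add: eval_var a)
    have "eval f a = eval (X [^]\<^bsub>?R\<^esub> Q) a \<oplus> eval (\<ominus>\<^bsub>?R\<^esub> X) a"
      unfolding f_def a_minus_def using X by (simp del: E.hom_a_inv)
    then show ?thesis using X by (simp add: pw eval_var a a_minus_def)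
  qed
  have root: "is_root f a \<longleftrightarrow> a \<in> ?K \<and> a [^] Q = a" for a
    unfolding is_root_def using f0 ev by auto
  have mult1: "alg_mult f a \<le> 1" if r: "is_root f a" for a
  proof (rule ccontr)
    assume "\<not> alg_mult f a \<le> 1"
    then have "2 \<le> alg_mult f a" by simp
    have a: "a \<in> ?K" and aQ: "a [^] Q = a" using r root by auto
    define b where "b = [\<one>, \<ominus> a]"
    define c where "c = poly_of_const a"
    have b: "b \<in> carrier ?R" unfolding b_def using a by (simp add: sym[OF univ_poly_carrier] polynomial_def)
    have c: "c \<in> carrier ?R" using cc a by (simp add: c_def)
    have Xbc: "X = b \<oplus>\<^bsub>?R\<^esub> c"
      unfolding b_def c_def poly_of_const_def var_def univ_poly_add using a
      by (cases "a = \<zero>") (simp_all add: l_neg)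
    have cQ: "c [^]\<^bsub>?R\<^esub> Q = c" using cpow[OF a, of Q] aQ by (simp add: c_def)
    \<comment> \<open>The constant \<open>c\<close> is fixed by the \<open>Q\<close>-th power
      because \<open>a\<close> is a root, so it cancels in \<open>f\<close> and
      \<open>b ^ Q - b\<close> remains.\<close>
    have "X [^]\<^bsub>?R\<^esub> Q = b [^]\<^bsub>?R\<^esub> Q \<oplus>\<^bsub>?R\<^esub> c [^]\<^bsub>?R\<^esub> Q"
      unfolding Xbc Q_def by (rule UP.freshman[OF p charUP b c])
    then have "f = (b [^]\<^bsub>?R\<^esub> Q \<oplus>\<^bsub>?R\<^esub> c) \<ominus>\<^bsub>?R\<^esub> (b \<oplus>\<^bsub>?R\<^esub> c)"
      unfolding f_def cQ Xbc by simp
    also have "b [^]\<^bsub>?R\<^esub> Q = b \<otimes>\<^bsub>?R\<^esub> b [^]\<^bsub>?R\<^esub> (Q - 1)"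
      using Q UP.nat_pow_Suc2[OF b, of "Q - 1"] by simp
    finally have fb: "f = b \<otimes>\<^bsub>?R\<^esub> (b [^]\<^bsub>?R\<^esub> (Q - 1) \<ominus>\<^bsub>?R\<^esub> \<one>\<^bsub>?R\<^esub>)"
      using b c UP.nat_pow_closed[OF b, of "Q - 1"] by algebra
    have "b [^]\<^bsub>?R\<^esub> (2::nat) pdivides f"
      unfolding b_def using le_alg_mult_imp_pdivides[OF a f \<open>2 \<le> alg_mult f a\<close>] .
    then obtain h where h: "h \<in> carrier ?R" "f = b [^]\<^bsub>?R\<^esub> (2::nat) \<otimes>\<^bsub>?R\<^esub> h"
      unfolding pdivides_def by auto
    have "f = b \<otimes>\<^bsub>?R\<^esub> (b \<otimes>\<^bsub>?R\<^esub> h)" using h b by (simp add: numeral_2_eq_2 UP.m_assoc)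
    moreover have "b \<noteq> \<zero>\<^bsub>?R\<^esub>" by (simp add: b_def univ_poly_zero)
    ultimately have "b \<otimes>\<^bsub>?R\<^esub> h = b [^]\<^bsub>?R\<^esub> (Q - 1) \<ominus>\<^bsub>?R\<^esub> \<one>\<^bsub>?R\<^esub>"
      using fb b h UP.m_lcancel[OF _ b, of "b \<otimes>\<^bsub>?R\<^esub> h" "b [^]\<^bsub>?R\<^esub> (Q - 1) \<ominus>\<^bsub>?R\<^esub> \<one>\<^bsub>?R\<^esub>"] by simp
    moreover have "b [^]\<^bsub>?R\<^esub> (Q - 1) = b \<otimes>\<^bsub>?R\<^esub> b [^]\<^bsub>?R\<^esub> (Q - 2)"
      using Q UP.nat_pow_Suc2[OF b, of "Q - 2"] by (simp add: Suc_diff_Suc numeral_2_eq_2)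
    ultimately have "b \<otimes>\<^bsub>?R\<^esub> h = b \<otimes>\<^bsub>?R\<^esub> b [^]\<^bsub>?R\<^esub> (Q - 2) \<ominus>\<^bsub>?R\<^esub> \<one>\<^bsub>?R\<^esub>" by simp
    \<comment> \<open>If \<open>b\<close> divided \<open>f\<close> twice, cancelling one
      \<open>b\<close> would make \<open>b\<close> a divisor of 1; evaluation at \<open>a\<close>,
      where \<open>b\<close> vanishes, refutes this.\<close>
    then have 1: "\<one>\<^bsub>?R\<^esub> = b \<otimes>\<^bsub>?R\<^esub> (b [^]\<^bsub>?R\<^esub> (Q - 2) \<ominus>\<^bsub>?R\<^esub> h)"
      using b h UP.nat_pow_closed[OF b, of "Q - 2"] by algebra
    interpret E: ring_hom_ring ?R L "\<lambda>p. eval p a" using eval_ring_hom[OF carrier_is_subring a] .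
    have "eval b a = \<zero>" unfolding b_def using a by (simp add: r_neg)
    then have "eval \<one>\<^bsub>?R\<^esub> a = \<zero>"
      using arg_cong[OF 1, of "\<lambda>p. eval p a"] b h by simp
    then show False using E.hom_one by simp
  qed
  have "card {x \<in> ?K. x [^] Q = x} = size (roots f)"
  proof -
    have set: "set_mset (roots f) = {x \<in> ?K. x [^] Q = x}"
      using roots_mem_iff_is_root[OF f] root by blast
    have "count (roots f) a = 1" if "a \<in># roots f" for a
      using that mult1[of a] roots_mem_iff_is_root[OF f, of a] alg_mult_eq_count_roots[OF f]
      by (metis One_nat_def Suc_leI count_greater_zero_iff le_antisym)
    then have "size (roots f) = (\<Sum>a\<in>set_mset (roots f). 1)"
      unfolding size_multiset_overloaded_eq by (intro sum.cong) auto
    then show ?thesis unfolding set by simp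
  qed
  also have "\<dots> = Q" using roots_over_carrier[OF f] \<open>degree f = Q\<close> by (simp add: splitted_def)
  finally show ?thesis by (simp add: Q_def)
qed

text \<open>The span is the image of the finite set of coefficient lists, and independence says that
  this parametrisation is injective; so comparing cardinalities decides it.\<close>

lemma (in ring) independent_iff_card_Span:
  assumes K: "subfield K R" and fin: "finite K" and Us: "set Us \<subseteq> carrier R"
  shows "independent K Us \<longleftrightarrow> card (Span K Us) = card K ^ length Us"
proof -
  define A where "A = {Ks. set Ks \<subseteq> K \<and> length Ks = length Us}"
  have KR: "K \<subseteq> carrier R" using subfieldE(3)[OF K] .
  have A: "finite A" "card A = card K ^ length Us"
    unfolding A_def using fin finite_lists_length_eq card_lists_length_eq by auto
  have Span: "Span K Us = (\<lambda>Ks. combine Ks Us) ` A"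
    using Span_eq_combine_set_length_version[OF K Us] unfolding A_def by auto
  have "card (Span K Us) = card K ^ length Us \<longleftrightarrow> inj_on (\<lambda>Ks. combine Ks Us) A"
    unfolding Span A(2)[symmetric] using inj_on_iff_eq_card[OF A(1)] by metis
  also have "\<dots> \<longleftrightarrow> independent K Us"
  proof
    assume inj: "inj_on (\<lambda>Ks. combine Ks Us) A"
    show "independent K Us"
    proof (rule ccontr)
      assume "dependent K Us"
      then obtain Ks where Ks: "length Ks = length Us" "combine Ks Us = \<zero>" "set Ks \<subseteq> K" "set Ks \<noteq> {\<zero>}"
        using dependent_imp_non_trivial_combine[OF K Us] by blast
      have z: "replicate (length Us) \<zero> \<in> A" "combine (replicate (length Us) \<zero>) Us = \<zero>"
        using subringE(2)[OF subfieldE(1)[OF K]] combine_replicate[OF Us] by (auto simp: A_def)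
      have "Ks = replicate (length Us) \<zero>"
        using inj_onD[OF inj _ _ z(1), of Ks] Ks z(2) by (simp add: A_def)
      \<comment> \<open>The condition \<open>set Ks \<noteq> {\<zero>}\<close> also holds for the
        empty list, so that case has to be refuted through \<open>Us = []\<close>.\<close>
      then have "set Ks \<subseteq> {\<zero>}" by (simp add: set_replicate_conv_if)
      then have "Ks = []" using Ks(4) by (cases Ks) auto
      then have "Us = []" using Ks(1) by simp
      then show False using \<open>dependent K Us\<close> by auto
    qed
  next
    assume ind: "independent K Us"
    show "inj_on (\<lambda>Ks. combine Ks Us) A"
    proof (rule inj_onI)
      fix Ks Ls assume "Ks \<in> A" "Ls \<in> A" and eq: "combine Ks Us = combine Ls Us"
      then have Ks: "set Ks \<subseteq> K" "length Ks = length Us" and Ls: "set Ls \<subseteq> K" "length Ls = length Us"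
        by (auto simp: A_def)
      have "combine Ks Us \<in> Span K Us" using Ks Span by (auto simp: A_def)
      from unique_decomposition[OF K ind this]
      show "Ks = Ls" using Ks Ls eq by blast
    qed
  qed
  finally show ?thesis ..
qed

subsection \<open>Frobenius and its stable subspaces\<close>

text \<open>Records what is used of the algebraic closure: the characteristic and the number of
  points fixed by each power of Frobenius.\<close>

locale frobenius_tower = field L for L (structure) +
  fixes p a q :: nat
  assumes prime_p: "prime p" and a_pos: "a > 0" and q_eq: "q = p ^ a"
    and char: "[p] \<cdot> \<one> = \<zero>"
    and card_fixed: "\<And>k. k > 0 \<Longrightarrow> card {x \<in> carrier L. x [^] (p ^ k) = x} = p ^ k"
begin

text \<open>For \<open>n > 0\<close> this is the copy in \<open>L\<close> of the field with
  \<open>q ^ n\<close> elements; \<open>V 0\<close> is all of \<open>L\<close>. The base field is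
  \<open>V 1\<close>.\<close>

definition V :: "nat \<Rightarrow> 'a set" where
  "V n = {x \<in> carrier L. x [^] (q ^ n) = x}"

lemma q_gt_1: "q > 1"
  unfolding q_eq using one_less_power[OF prime_gt_1_nat[OF prime_p] a_pos] .

lemma q_pow_pos [simp]: "q ^ n > 0"
  using q_gt_1 by simp

lemma frob_add:
  "x \<in> carrier L \<Longrightarrow> y \<in> carrier L \<Longrightarrow> (x \<oplus> y) [^] (q ^ i) = x [^] (q ^ i) \<oplus> y [^] (q ^ i)"
  using freshman[OF prime_p char, of x y "a * i"] by (simp add: q_eq power_mult)

lemma frob_pow: "x \<in> carrier L \<Longrightarrow> (x [^] (q ^ i)) [^] (q ^ j) = x [^] (q ^ (i + j))"
  by (simp add: nat_pow_pow power_add)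

lemma frob_zero [simp]: "\<zero> [^] (q ^ i) = \<zero>"
  using nat_pow_zero q_pow_pos by (metis less_irrefl)

lemma frob_minus: "x \<in> carrier L \<Longrightarrow> (\<ominus> x) [^] (q ^ i) = \<ominus> (x [^] (q ^ i))"
  using frob_add[of x "\<ominus> x" i]
  by (metis a_comm add.inv_closed frob_zero minus_equality nat_pow_closed r_neg)

lemma frob_finsum:
  "f \<in> I \<rightarrow> carrier L \<Longrightarrow> (finsum L f I) [^] (q ^ i) = finsum L (\<lambda>j. f j [^] (q ^ i)) I"
  using additive_finsum[of "\<lambda>x. x [^] (q ^ i)" f I] frob_add by simp

lemma V_carrier: "V n \<subseteq> carrier L" "x \<in> V n \<Longrightarrow> x \<in> carrier L"
  by (auto simp: V_def)

lemma V_fixed: "x \<in> V n \<Longrightarrow> x [^] (q ^ n) = x"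
  by (simp add: V_def)

lemma V_closed [simp]:
  "\<zero> \<in> V n" "\<one> \<in> V n"
  "x \<in> V n \<Longrightarrow> y \<in> V n \<Longrightarrow> x \<oplus> y \<in> V n"
  "x \<in> V n \<Longrightarrow> y \<in> V n \<Longrightarrow> x \<otimes> y \<in> V n"
  "x \<in> V n \<Longrightarrow> \<ominus> x \<in> V n"
  "x \<in> V n \<Longrightarrow> x [^] (k::nat) \<in> V n"
proof -
  show "x [^] (k::nat) \<in> V n" if "x \<in> V n"
  proof -
    have "(x [^] k) [^] (q ^ n) = (x [^] (q ^ n)) [^] k"
      using that nat_pow_pow[of x k "q ^ n"] nat_pow_pow[of x "q ^ n" k]
      by (simp add: V_def mult.commute)
    then show ?thesis using that by (simp add: V_def)
  qed
qed (simp_all add: V_def frob_add frob_minus nat_pow_distrib)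

lemma V_mono: assumes "m dvd n" shows "V m \<subseteq> V n"
proof
  fix x assume x: "x \<in> V m"
  from assms obtain k where n: "n = m * k" by auto
  have "x [^] (q ^ (m * k)) = x"
    by (induction k) (use x in \<open>simp_all add: V_carrier V_fixed frob_pow[symmetric] add.commute[of m]\<close>)
  then show "x \<in> V n" using x n by (simp add: V_def)
qed

lemma V1_fixed: "c \<in> V 1 \<Longrightarrow> c [^] (q ^ i) = c"
  using V_mono[of 1 i] V_fixed by auto

lemma card_V: assumes "n > 0" shows "card (V n) = q ^ n" and "finite (V n)"
proof -
  show "card (V n) = q ^ n"
    using card_fixed[of "a * n"] assms a_pos by (simp add: V_def power_mult flip: q_eq)
  then show "finite (V n)" using q_pow_pos[of n] card_ge_0_finite by metis
qed

lemma subfield_V: "subfield (V n) L"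
proof (rule subfieldI')
  show "subring (V n) L"
    by (rule subringI) (auto simp: V_carrier)
  fix k assume k: "k \<in> V n - {\<zero>}"
  then have kU: "k \<in> Units L" using field_Units V_carrier by auto
  have kL: "k \<in> carrier L" "inv k \<in> carrier L" "k [^] (q ^ n) = k"
    using kU k V_fixed by auto
  have "inv k [^] (q ^ n) = inv k [^] (q ^ n) \<otimes> k \<otimes> inv k"
    using kU kL by (simp add: m_assoc)
  also have "inv k [^] (q ^ n) \<otimes> k = inv k [^] (q ^ n) \<otimes> k [^] (q ^ n)" using kL by simp
  also have "\<dots> = (inv k \<otimes> k) [^] (q ^ n)" using kL by (simp only: nat_pow_distrib)
  finally have "inv k [^] (q ^ n) = inv k" using kU kL by simp
  then show "inv k \<in> V n" using kL by (simp add: V_def)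
qed

text \<open>With \<open>\<sigma>\<close> the map \<open>x \<mapsto> x ^ q\<close>, these are the
  submodules of \<open>V n\<close> over polynomials in \<open>\<sigma>\<close> with coefficients in
  \<open>V 1\<close>.\<close>

definition submodule :: "nat \<Rightarrow> 'a set \<Rightarrow> bool" where
  "submodule n U \<longleftrightarrow> U \<subseteq> V n \<and> \<zero> \<in> U \<and> (\<forall>x\<in>U. \<forall>y\<in>U. x \<oplus> y \<in> U) \<and>
     (\<forall>c\<in>V 1. \<forall>x\<in>U. c \<otimes> x \<in> U) \<and> (\<forall>x\<in>U. x [^] q \<in> U)"

definition conj :: "nat \<Rightarrow> 'a \<Rightarrow> 'a list" where
  "conj n \<beta> = map (\<lambda>i. \<beta> [^] (q ^ i)) [0..<n]"

lemma conj_carrier: "\<beta> \<in> carrier L \<Longrightarrow> set (conj n \<beta>) \<subseteq> carrier L"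
  by (auto simp: conj_def)

lemma submodule_pow: 
  assumes "submodule n U" "x \<in> U" shows "x [^] (q ^ i) \<in> U"
proof (induction i)
  case (Suc i)
  have "x \<in> carrier L" using assms V_carrier by (auto simp: submodule_def)
  then have "x [^] (q ^ Suc i) = (x [^] (q ^ i)) [^] q" by (simp add: nat_pow_pow mult.commute)
  then show ?case using Suc assms by (simp add: submodule_def)
qed (use assms V_carrier in \<open>auto simp: submodule_def\<close>)

lemma submodule_minus:
  assumes "submodule n U" "x \<in> U" shows "\<ominus> x \<in> U"
proof -
  have "x \<in> carrier L" using assms V_carrier by (auto simp: submodule_def)
  then have "\<ominus> x = (\<ominus> \<one>) \<otimes> x" by (simp add: l_minus)
  then show ?thesis using assms by (simp add: submodule_def)
qed

lemma submodule_V: "submodule n (V n)"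
  using V_mono[of 1 n] by (auto simp: submodule_def)

lemma Span_conj_subset:
  assumes U: "submodule n U" "\<beta> \<in> U"
  shows "Span (V 1) (conj n \<beta>) \<subseteq> U"
proof -
  have "\<beta> \<in> carrier L" using U V_carrier by (auto simp: submodule_def)
  note cs = conj_carrier[OF this, of n]
  show ?thesis
  proof (rule Span_min[OF subfield_V cs])
    show "subgroup U (add_monoid L)"
      by (rule add.subgroupI)
        (use U V_carrier submodule_minus[OF U(1)] in \<open>auto simp: submodule_def a_inv_def[symmetric]\<close>)
    show "V 1 <#> set (conj n \<beta>) \<subseteq> U"
      using U submodule_pow[OF U] unfolding set_mult_def conj_def submodule_def by auto
  qed
qed

text \<open>The span of the conjugates is stable under Frobenius and so is the least submodule
  containing \<open>\<beta>\<close>; it is everything iff \<open>\<beta>\<close> lies in no proper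
  submodule.\<close>

lemma Span_conj_eq_iff:
  assumes n: "n > 0" and \<beta>: "\<beta> \<in> V n"
  shows "Span (V 1) (conj n \<beta>) = V n \<longleftrightarrow> (\<forall>U. submodule n U \<and> \<beta> \<in> U \<longrightarrow> U = V n)"
proof -
  have \<beta>L: "\<beta> \<in> carrier L" using \<beta> V_carrier by auto
  note cs = conj_carrier[OF \<beta>L, of n] and sf = subfield_V[of 1]
  note min = Span_conj_subset and VnSub = submodule_V[of n]
  have sub: "submodule n (Span (V 1) (conj n \<beta>))"
  proof -
    let ?S = "Span (V 1) (conj n \<beta>)"
    have SV: "?S \<subseteq> V n" using min[OF VnSub \<beta>] .
    \<comment> \<open>Exponents may be reduced modulo \<open>n\<close>: Frobenius takes the last
      conjugate of the list back to the first.\<close>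
    have frob: "\<beta> [^] (q ^ i) \<in> ?S" for i
    proof -
      have "\<beta> [^] (q ^ (j * n)) = \<beta>" for j
        using V_mono[of n "j * n"] \<beta> V_fixed by auto
      then have "\<beta> [^] (q ^ i) = \<beta> [^] (q ^ (i mod n))"
        using frob_pow[OF \<beta>L, of "i div n * n" "i mod n"] by simp
      also have "\<dots> \<in> set (conj n \<beta>)" using n by (auto simp: conj_def)
      finally show ?thesis using Span_base_incl[OF sf cs] by blast
    qed
    \<comment> \<open>Stability comes from minimality of the span: the elements whose image under
      Frobenius stays in the span form a subgroup containing all scalar multiples of
      conjugates.\<close>
    have "?S \<subseteq> {x \<in> V n. x [^] q \<in> ?S}"
    proof (rule Span_min[OF sf cs])
      note P = Span_subgroup_props[OF sf cs]
      show "subgroup {x \<in> V n. x [^] q \<in> ?S} (add_monoid L)"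
      proof (rule add.subgroupI)
        show "{x \<in> V n. x [^] q \<in> ?S} \<noteq> {}"
          using P(2) frob_zero[of 1] by (auto simp del: Span.simps intro!: exI[of _ \<zero>])
      qed (use P V_carrier frob_add[of _ _ 1] frob_minus[of _ 1] in
            \<open>auto simp: a_inv_def[symmetric] simp del: Span.simps\<close>)
      show "V 1 <#> set (conj n \<beta>) \<subseteq> {x \<in> V n. x [^] q \<in> ?S}"
      proof
        fix y assume "y \<in> V 1 <#> set (conj n \<beta>)"
        then obtain c i where c: "c \<in> V 1" and y: "y = c \<otimes> \<beta> [^] (q ^ i)"
          unfolding set_mult_def conj_def by auto
        have "y [^] q = c \<otimes> \<beta> [^] (q ^ Suc i)"
          using c V_carrier \<beta>L V1_fixed[OF c, of 1] unfolding y
          by (simp add: nat_pow_distrib nat_pow_pow mult.commute)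
        moreover have "c \<in> V n" using c V_mono[of 1 n] by auto
        ultimately show "y \<in> {x \<in> V n. x [^] q \<in> ?S}"
          using frob[of "Suc i"] Span_smult_closed[OF sf cs c] y \<beta> by simp
      qed
    qed
    then have fr: "x [^] q \<in> ?S" if "x \<in> ?S" for x using that by blast
    show ?thesis
      unfolding submodule_def
      by (intro conjI ballI SV fr Span_subgroup_props(2,3)[OF sf cs] Span_smult_closed[OF sf cs])
  qed
  have "\<beta> \<in> Span (V 1) (conj n \<beta>)"
  proof -
    have "\<beta> \<in> set (conj n \<beta>)" using n \<beta>L by (auto simp: conj_def intro!: image_eqI[of _ _ 0])
    then show ?thesis using Span_base_incl[OF sf cs] by blast
  qed
  moreover have "Span (V 1) (conj n \<beta>) \<subseteq> V n" using min[OF VnSub \<beta>] .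
  moreover have "U \<subseteq> V n" if "submodule n U" for U using that by (simp add: submodule_def)
  ultimately show ?thesis using min sub by (metis subset_antisym)
qed

end

text \<open>Each fibre over a point of the image is a translate of the kernel; \<open>S\<close> is
  confined to the image so that no fibre is empty. This is the counting device for the operators
  \<open>N m\<close> and for the trace.\<close>

lemma (in abelian_group) card_additive_vimage:
  assumes A: "A \<subseteq> carrier G" "finite A" "\<And>x y. x \<in> A \<Longrightarrow> y \<in> A \<Longrightarrow> x \<oplus> y \<in> A"
      "\<And>x. x \<in> A \<Longrightarrow> \<ominus> x \<in> A"
    and T: "\<And>x. x \<in> A \<Longrightarrow> T x \<in> carrier G"
      "\<And>x y. x \<in> A \<Longrightarrow> y \<in> A \<Longrightarrow> T (x \<oplus> y) = T x \<oplus> T y"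
    and S: "S \<subseteq> T ` A"
  shows "card {x \<in> A. T x \<in> S} = card {x \<in> A. T x = \<zero>} * card S"
proof -
  have fiber: "card {x \<in> A. T x = s} = card {x \<in> A. T x = \<zero>}" if "s \<in> S" for s
  proof -
    from that S obtain x0 where x0: "x0 \<in> A" "T x0 = s" by auto
    have "bij_betw (\<lambda>x. x0 \<oplus> x) {x \<in> A. T x = \<zero>} {x \<in> A. T x = s}"
    proof (rule bij_betw_byWitness[where f' = "\<lambda>x. \<ominus> x0 \<oplus> x"])
      have x0c: "x0 \<in> carrier G" "T x0 \<in> carrier G" using x0 A T by auto
      have Tm: "T (\<ominus> x0 \<oplus> x) = \<zero>" if "x \<in> A" "T x = s" for x
      proof -
        have "x0 \<oplus> (\<ominus> x0 \<oplus> x) = x"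
          using that(1) A(1) x0c by (intro r_neg2) auto
        then have "T x0 \<oplus> T (\<ominus> x0 \<oplus> x) = T x"
          using T(2)[OF x0(1), of "\<ominus> x0 \<oplus> x"] A x0(1) that by simp
        moreover have "T (\<ominus> x0 \<oplus> x) \<in> carrier G" using T(1) A x0(1) that by simp
        ultimately show ?thesis
          using add.l_cancel[of "T x0" "T (\<ominus> x0 \<oplus> x)" \<zero>] that(2) x0(2) x0c(2) r_zero zero_closed
          by (simp only:)
      qed
      show "(\<lambda>x. x0 \<oplus> x) ` {x \<in> A. T x = \<zero>} \<subseteq> {x \<in> A. T x = s}"
        using A(3) T(2) x0 x0c by auto
      show "(\<lambda>x. \<ominus> x0 \<oplus> x) ` {x \<in> A. T x = s} \<subseteq> {x \<in> A. T x = \<zero>}"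
        using Tm A(3,4) x0 by auto
      show "\<forall>x\<in>{x \<in> A. T x = \<zero>}. \<ominus> x0 \<oplus> (x0 \<oplus> x) = x"
      proof
        fix x assume "x \<in> {x \<in> A. T x = \<zero>}"
        then have "x \<in> carrier G" using A(1) by blast
        then show "\<ominus> x0 \<oplus> (x0 \<oplus> x) = x" using x0c(1) by (rule r_neg1[rotated])
      qed
      show "\<forall>x\<in>{x \<in> A. T x = s}. x0 \<oplus> (\<ominus> x0 \<oplus> x) = x"
      proof
        fix x assume "x \<in> {x \<in> A. T x = s}"
        then have "x \<in> carrier G" using A(1) by blast
        then show "x0 \<oplus> (\<ominus> x0 \<oplus> x) = x" using x0c(1) by (rule r_neg2[rotated])
      qed
    qed
    then show ?thesis by (rule bij_betw_same_card[symmetric])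
  qed
  have finS: "finite S" using S A(2) finite_subset by blast
  have "{x \<in> A. T x \<in> S} = (\<Union>s\<in>S. {x \<in> A. T x = s})" by auto
  then have "card {x \<in> A. T x \<in> S} = (\<Sum>s\<in>S. card {x \<in> A. T x = s})"
    using A(2) finS by (simp only:) (subst card_UN_disjoint, auto)
  then show ?thesis using fiber by simp
qed

section \<open>The trace from \<open>V (p * m)\<close> to \<open>V m\<close>\<close>

context frobenius_tower
begin

text \<open>Normality as generation of the module \<open>V n\<close>. In this form it passes through
  the trace; \<open>normal_iff_basis\<close> relates it to bases of conjugates.\<close>

definition normal :: "nat \<Rightarrow> 'a \<Rightarrow> bool" where
  "normal n \<beta> \<longleftrightarrow> \<beta> \<in> V n \<and> (\<forall>U. submodule n U \<and> \<beta> \<in> U \<longrightarrow> U = V n)"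

text \<open>In operator terms this is \<open>\<sigma> ^ m - 1\<close>, with \<open>\<sigma>\<close>
  the \<open>q\<close>-power Frobenius.\<close>

definition N :: "nat \<Rightarrow> 'a \<Rightarrow> 'a" where
  "N m x = x [^] (q ^ m) \<ominus> x"

lemma N_eq_zero_iff: "x \<in> carrier L \<Longrightarrow> N m x = \<zero> \<longleftrightarrow> x \<in> V m"
  by (simp add: N_def V_def)

lemma N_pow_V: "x \<in> V n \<Longrightarrow> (N m ^^ i) x \<in> V n"
  by (induction i) (simp_all add: N_def a_minus_def)

lemma N_pow_closed: "x \<in> carrier L \<Longrightarrow> (N m ^^ i) x \<in> carrier L"
  by (induction i) (simp_all add: N_def)

lemma N_add: "x \<in> carrier L \<Longrightarrow> y \<in> carrier L \<Longrightarrow> N m (x \<oplus> y) = N m x \<oplus> N m y"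
  unfolding N_def by (simp add: frob_add a_minus_def minus_add a_ac)

lemma N_pow_add:
  assumes "x \<in> carrier L" "y \<in> carrier L"
  shows "(N m ^^ i) (x \<oplus> y) = (N m ^^ i) x \<oplus> (N m ^^ i) y"
  by (induction i) (simp_all add: N_add N_pow_closed assms)

lemma N_closed: "x \<in> carrier L \<Longrightarrow> N m x \<in> carrier L"
  by (simp add: N_def)

lemma N_pow_smult:
  assumes "x \<in> carrier L" "c \<in> V 1"
  shows "(N m ^^ i) (c \<otimes> x) = c \<otimes> (N m ^^ i) x"
proof (induction i)
  case (Suc i)
  have c: "c \<in> carrier L" using assms V_carrier by auto
  have "N m (c \<otimes> u) = c \<otimes> N m u" if "u \<in> carrier L" for u
    using that c V1_fixed[OF assms(2)] unfolding N_def
    by (simp add: nat_pow_distrib a_minus_def r_distr r_minus)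
  then show ?case using Suc N_pow_closed[OF assms(1)] by simp
qed simp

lemma N_pow_frob:
  assumes "x \<in> carrier L"
  shows "(N m ^^ i) (x [^] q) = ((N m ^^ i) x) [^] q"
proof (induction i)
  case (Suc i)
  have "N m (u [^] q) = N m u [^] q" if u: "u \<in> carrier L" for u
  proof -
    have "N m u [^] q = (u [^] (q ^ m)) [^] q \<oplus> \<ominus> (u [^] q)"
      using u frob_add[of "u [^] (q ^ m)" "\<ominus> u" 1] frob_minus[of u 1]
      by (simp add: N_def a_minus_def)
    then show ?thesis using u by (simp add: N_def a_minus_def nat_pow_pow mult.commute)
  qed
  then show ?case using Suc N_pow_closed[OF assms] by simp
qed simp

text \<open>In characteristic \<open>p\<close>,
  \<open>(\<sigma> ^ m - 1) ^ p = \<sigma> ^ (p * m) - 1\<close>, which kills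
  \<open>V (p * m)\<close>. The identity is obtained by expanding
  \<open>(N m + 1) ^ p\<close>.\<close>

lemma N_pow_p:
  assumes x: "x \<in> V (p * m)"
  shows "(N m ^^ p) x = \<zero>"
proof -
  have xL: "x \<in> carrier L" using x V_carrier by auto
  have char': "[p] \<cdot> z = \<zero>" if "z \<in> carrier L" for z
    using add_pow_ldistr[of \<one> z p] char that by simp
  have "((\<lambda>x. N m x \<oplus> x) ^^ p) x = (N m ^^ p) x \<oplus> ((\<lambda>x. x) ^^ p) x"
    by (rule commuting_freshman)
      (use N_add N_closed xL prime_p char' in auto)
  moreover have "((\<lambda>x. N m x \<oplus> x) ^^ i) x = x [^] (q ^ (i * m))" for i
  proof (induction i)
    case (Suc i)
    have "N m u \<oplus> u = u [^] (q ^ m)" if "u \<in> carrier L" for u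
      using that by (simp add: N_def a_minus_def a_assoc l_neg)
    then show ?case using Suc xL by (simp add: frob_pow add.commute)
  qed (use xL in simp)
  moreover have "((\<lambda>x. x) ^^ p) x = x" by (induction p) auto
  ultimately have "(N m ^^ p) x \<oplus> x = x" using V_fixed[OF x] by simp
  then show ?thesis using xL add.r_cancel_one[of x "(N m ^^ p) x"] N_pow_closed[OF xL] by blast
qed

text \<open>The kernel of \<open>N m\<close> is \<open>V m\<close>, so each further application of
  \<open>N m\<close> multiplies the size of the kernel by at most \<open>q ^ m\<close>.\<close>

lemma N_ker_bound:
  assumes "m > 0" "n > 0" shows "card {x \<in> V n. (N m ^^ i) x = \<zero>} \<le> (q ^ m) ^ i"
proof (induction i)
  case 0
  have "{x \<in> V n. x = \<zero>} = {\<zero>}" by auto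
  then show ?case by simp
next
  case (Suc i)
  define S where "S = {y \<in> (N m ^^ i) ` V n. N m y = \<zero>}"
  have "S \<subseteq> V m"
    unfolding S_def using N_eq_zero_iff N_pow_V V_carrier by blast
  then have "card S \<le> q ^ m" using card_V[OF assms(1)] card_mono by metis
  have "{x \<in> V n. (N m ^^ Suc i) x = \<zero>} = {x \<in> V n. (N m ^^ i) x \<in> S}"
    unfolding S_def by auto
  also have "card \<dots> = card {x \<in> V n. (N m ^^ i) x = \<zero>} * card S"
    by (rule card_additive_vimage)
      (use V_carrier card_V[OF assms(2)] N_pow_add N_pow_closed in \<open>auto simp: S_def\<close>)
  also have "\<dots> \<le> (q ^ m) ^ i * q ^ m" using Suc \<open>card S \<le> q ^ m\<close> by (rule mult_le_mono)
  finally show ?case by (simp add: mult.commute)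
qed

context
  fixes m :: nat
  assumes m: "m > 0"
begin

text \<open>
  \<open>T\<close> is the trace from \<open>V (p * m)\<close> to \<open>V m\<close>, since \<open>(X - 1) ^ (p - 1) = 1 + X + \<dots> + X ^ (p - 1)\<close> in
  characteristic \<open>p\<close>.
\<close>

definition T :: "'a \<Rightarrow> 'a" where "T = N m ^^ (p - 1)"

lemma p_pos: "p > 0" using prime_p by (simp add: prime_gt_0_nat)

lemma N_T: "N m (T x) = (N m ^^ p) x" "T (N m x) = (N m ^^ p) x"
  unfolding T_def using p_pos funpow_swap1[of "N m" "p - 1" x] by (cases p; simp)+

text \<open>Pure counting. Kernel and image of \<open>T\<close> have at most
  \<open>q ^ ((p - 1) * m)\<close> and \<open>q ^ m\<close> elements, while the product of their
  sizes is \<open>q ^ (p * m)\<close>, so both bounds are attained. The image of \<open>N m\<close>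
  lies in the kernel of \<open>T\<close> because \<open>T\<close> after \<open>N m\<close> is
  \<open>N m ^^ p\<close>, and it has the same size.\<close>

lemma T_facts:
  shows T_image: "T ` V (p * m) = V m" 
    and T_card_ker: "card {x \<in> V (p * m). T x = \<zero>} = q ^ (p * m - m)"
    and T_ker: "{x \<in> V (p * m). T x = \<zero>} = N m ` V (p * m)"
proof -
  let ?V = "V (p * m)"
  have n: "p * m > 0" using m p_pos by simp
  have into: "T ` ?V \<subseteq> V m"
  proof
    fix y assume "y \<in> T ` ?V"
    then obtain x where x: "x \<in> ?V" "y = T x" by auto
    have "N m y = \<zero>" using N_pow_p[OF x(1)] N_T x by simp
    moreover have "y \<in> carrier L" using N_pow_V[OF x(1)] V_carrier x(2) by (auto simp: T_def)
    ultimately show "y \<in> V m" using N_eq_zero_iff by blast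
  qed
  have pm: "p * m = (p - 1) * m + m" using p_pos by (cases p) auto
  have split: "q ^ (p * m) = q ^ ((p - 1) * m) * q ^ m" unfolding pm by (simp add: power_add)
  have 1: "card {x \<in> ?V. T x \<in> T ` ?V} = card {x \<in> ?V. T x = \<zero>} * card (T ` ?V)"
    by (rule card_additive_vimage) (use V_carrier card_V[OF n] N_pow_add N_pow_closed in \<open>auto simp: T_def\<close>)
  have "{x \<in> ?V. T x \<in> T ` ?V} = ?V" by auto
  then have 2: "q ^ ((p - 1) * m) * q ^ m = card {x \<in> ?V. T x = \<zero>} * card (T ` ?V)"
    using 1 card_V[OF n] split by simp
  have k: "card {x \<in> ?V. T x = \<zero>} \<le> q ^ ((p - 1) * m)"
    using N_ker_bound[OF m n, of "p - 1"] by (simp add: T_def mult.commute power_mult)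
  have i: "card (T ` ?V) \<le> q ^ m" using into card_V[OF m] card_mono by metis
  have i': "card (T ` ?V) = q ^ m"
  proof (rule ccontr)
    assume "card (T ` ?V) \<noteq> q ^ m"
    then have "card (T ` ?V) < q ^ m" using i by simp
    then have "card {x \<in> ?V. T x = \<zero>} * card (T ` ?V) < q ^ ((p - 1) * m) * q ^ m"
      using le_less_trans[OF mult_le_mono1[OF k] mult_less_mono2[OF _ q_pow_pos]] by blast
    then show False using 2 by simp
  qed
  then show "T ` ?V = V m" using into card_V[OF m] by (intro card_subset_eq) auto
  have k': "card {x \<in> ?V. T x = \<zero>} = q ^ ((p - 1) * m)"
    using 2 unfolding i' mult_cancel2 using q_pow_pos[of m] by linarith
  then show "card {x \<in> ?V. T x = \<zero>} = q ^ (p * m - m)" using pm by simp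
  have 3: "card {x \<in> ?V. N m x \<in> N m ` ?V} = card {x \<in> ?V. N m x = \<zero>} * card (N m ` ?V)"
    by (rule card_additive_vimage) (use V_carrier card_V[OF n] N_add N_closed in auto)
  have "{x \<in> ?V. N m x \<in> N m ` ?V} = ?V" by auto
  moreover have "{x \<in> ?V. N m x = \<zero>} = V m"
    using N_eq_zero_iff V_mono[of m "p * m"] V_carrier by auto
  ultimately have "card (N m ` ?V) = q ^ ((p - 1) * m)"
    using 3 card_V[OF n] card_V[OF m] split q_gt_1 by (simp add: gr_implies_not0[OF q_gt_1])
  moreover have "N m ` ?V \<subseteq> {x \<in> ?V. T x = \<zero>}"
    using N_T N_pow_p N_pow_V[of _ _ 1] by auto
  ultimately show "{x \<in> ?V. T x = \<zero>} = N m ` ?V"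
    using k' card_V(2)[OF n] card_subset_eq[of "{x \<in> ?V. T x = \<zero>}" "N m ` ?V"] by simp
qed

lemma T_add: "x \<in> carrier L \<Longrightarrow> y \<in> carrier L \<Longrightarrow> T (x \<oplus> y) = T x \<oplus> T y"
  and T_closed: "x \<in> carrier L \<Longrightarrow> T x \<in> carrier L"
  and T_smult: "x \<in> carrier L \<Longrightarrow> c \<in> V 1 \<Longrightarrow> T (c \<otimes> x) = c \<otimes> T x"
  and T_frob: "x \<in> carrier L \<Longrightarrow> T (x [^] q) = T x [^] q"
  unfolding T_def by (rule N_pow_add N_pow_closed N_pow_smult N_pow_frob; assumption)+

lemma T_zero: "T \<zero> = \<zero>"
  using T_smult[OF zero_closed, of \<zero>] T_closed[OF zero_closed] by simp

text \<open>
  The converse direction is Nakayama's lemma for the nilpotent operator \<open>N m\<close>, whose image is the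
  kernel of \<open>T\<close>.
\<close>

lemma normal_T_iff:
  assumes \<beta>: "\<beta> \<in> V (p * m)"
  shows "normal (p * m) \<beta> \<longleftrightarrow> normal m (T \<beta>)"
proof
  let ?V = "V (p * m)"
  have T\<beta>: "T \<beta> \<in> V m" using T_image \<beta> by auto
  assume nb: "normal (p * m) \<beta>"
  show "normal m (T \<beta>)"
    unfolding normal_def
  proof (intro conjI allI impI T\<beta>)
    fix U assume U: "submodule m U \<and> T \<beta> \<in> U"
    \<comment> \<open>Since \<open>T\<close> is onto, a proper submodule of \<open>V m\<close>
      containing \<open>T \<beta>\<close> would pull back to a proper one containing
      \<open>\<beta>\<close>.\<close>
    have "submodule (p * m) {x \<in> ?V. T x \<in> U}"
      using U V_carrier T_add T_smult T_frob T_zero V_mono[of 1 "p * m"] unfolding submodule_def by auto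
    then have "{x \<in> ?V. T x \<in> U} = ?V"
      using nb U \<beta> unfolding normal_def by blast
    then have "T ` ?V \<subseteq> U" by auto
    then have "V m \<subseteq> U" using T_image by simp
    then show "U = V m" using U unfolding submodule_def by blast
  qed
next
  let ?V = "V (p * m)"
  assume nT: "normal m (T \<beta>)"
  show "normal (p * m) \<beta>"
    unfolding normal_def
  proof (intro conjI allI impI \<beta>)
    fix U assume "submodule (p * m) U \<and> \<beta> \<in> U"
    then have U: "submodule (p * m) U" "\<beta> \<in> U" by auto
    then have UV: "U \<subseteq> ?V" by (simp add: submodule_def)
    have UL: "u \<in> carrier L" if "u \<in> U" for u using that UV V_carrier by auto
    have "submodule m (T ` U)"
      unfolding submodule_def
    proof (intro conjI ballI)
      show "T ` U \<subseteq> V m" using T_image UV by auto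
      show "\<zero> \<in> T ` U" using U(1) T_zero by (force simp: submodule_def)
    next
      fix x y assume "x \<in> T ` U" "y \<in> T ` U"
      then obtain u v where uv: "u \<in> U" "x = T u" "v \<in> U" "y = T v" by auto
      then have "x \<oplus> y = T (u \<oplus> v)" using T_add[OF UL UL] by simp
      then show "x \<oplus> y \<in> T ` U" using U(1) uv by (auto simp: submodule_def)
    next
      fix c x assume c: "c \<in> V 1" "x \<in> T ` U"
      then obtain u where u: "u \<in> U" "x = T u" by auto
      then have "c \<otimes> x = T (c \<otimes> u)" using T_smult[OF UL c(1)] by simp
      then show "c \<otimes> x \<in> T ` U" using U(1) u c by (auto simp: submodule_def)
    next
      fix x assume "x \<in> T ` U"
      then obtain u where u: "u \<in> U" "x = T u" by auto
      then have "x [^] q = T (u [^] q)" using T_frob[OF UL] by simp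
      then show "x [^] q \<in> T ` U" using U(1) u by (auto simp: submodule_def)
    qed
    then have TU: "T ` U = V m" using nT U(2) unfolding normal_def by blast
    have NU: "N m u \<in> U" if "u \<in> U" for u
      using submodule_pow[OF U(1) that, of m] submodule_minus[OF U(1) that] U(1)
      by (simp add: N_def a_minus_def submodule_def)
    \<comment> \<open>\<open>T\<close> maps \<open>U\<close> onto \<open>V m\<close>, so
      \<open>v\<close> differs from some \<open>u\<close> in \<open>U\<close> by an element of the
      kernel of \<open>T\<close>, which is the image of \<open>N m\<close>.\<close>
    have step: "\<exists>u\<in>U. \<exists>w\<in>?V. v = u \<oplus> N m w" if v: "v \<in> ?V" for v
    proof -
      obtain u where u: "u \<in> U" "T v = T u" using T_image TU v by blast
      have uV: "u \<in> ?V" "u \<in> carrier L" "v \<in> carrier L" using u UV UL V_carrier v by auto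
      have "T (\<ominus> u \<oplus> v) = \<zero>"
      proof -
        have "T u \<oplus> T (\<ominus> u \<oplus> v) = T (u \<oplus> (\<ominus> u \<oplus> v))" using uV by (simp add: T_add)
        also have "u \<oplus> (\<ominus> u \<oplus> v) = v" using uV by (simp add: r_neg2)
        finally have "T u \<oplus> T (\<ominus> u \<oplus> v) = T u \<oplus> \<zero>"
          using u(2) uV T_closed by simp
        moreover have "T u \<in> carrier L" "T (\<ominus> u \<oplus> v) \<in> carrier L" by (rule T_closed; use uV in simp)+
        ultimately show ?thesis
          using add.l_cancel[of "T u" "T (\<ominus> u \<oplus> v)" \<zero>] zero_closed by (simp only:)
      qed
      then have "\<ominus> u \<oplus> v \<in> {x \<in> ?V. T x = \<zero>}" using uV(1) v by simp
      then have "\<ominus> u \<oplus> v \<in> N m ` ?V" unfolding T_ker .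
      then obtain w where w: "w \<in> ?V" "\<ominus> u \<oplus> v = N m w" by auto
      have "v = u \<oplus> N m w" using uV by (simp add: w(2)[symmetric] r_neg2)
      then show ?thesis using u w by blast
    qed
    \<comment> \<open>Substituting the decomposition of \<open>w\<close> into that of
      \<open>v\<close> raises the power of \<open>N m\<close>; at power \<open>p\<close> the second
      term vanishes.\<close>
    have "\<exists>u\<in>U. \<exists>w\<in>?V. v = u \<oplus> (N m ^^ i) w" if v: "v \<in> ?V" for v i
    proof (induction i)
      case 0
      then show ?case using v U(1) V_carrier by (intro bexI[of _ \<zero>] bexI[of _ v]) (auto simp: submodule_def)
    next
      case (Suc i)
      then obtain u w where uw: "u \<in> U" "w \<in> ?V" "v = u \<oplus> (N m ^^ i) w" by blast
      obtain u' w' where uw': "u' \<in> U" "w' \<in> ?V" "w = u' \<oplus> N m w'" using step[OF uw(2)] by blast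
      have NiU: "(N m ^^ i) u' \<in> U" using NU uw'(1) by (induction i) auto
      have c: "w' \<in> carrier L" "u' \<in> carrier L" "N m w' \<in> carrier L" "u \<in> carrier L"
        using uw uw' V_carrier UL N_closed[of w' m] by auto
      have "v = u \<oplus> ((N m ^^ i) u' \<oplus> (N m ^^ i) (N m w'))"
        using uw uw' N_pow_add[OF c(2,3)] by simp
      also have "(N m ^^ i) (N m w') = (N m ^^ Suc i) w'" by (simp only: funpow_Suc_right o_apply)
      finally have "v = (u \<oplus> (N m ^^ i) u') \<oplus> (N m ^^ Suc i) w'"
        using a_assoc[OF c(4) UL[OF NiU] N_pow_closed[OF c(1)]] by metis
      moreover have "u \<oplus> (N m ^^ i) u' \<in> U" using U(1) uw(1) NiU by (simp add: submodule_def)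
      ultimately show ?case using uw'(2) by blast
    qed
    note decomp = this
    have "?V \<subseteq> U"
    proof
      fix v assume v: "v \<in> ?V"
      from decomp[OF v, of p] obtain u w where uw: "u \<in> U" "w \<in> ?V" "v = u \<oplus> (N m ^^ p) w" by blast
      have "v = u" unfolding uw(3) N_pow_p[OF uw(2)] using UL[OF uw(1)] by simp
      then show "v \<in> U" using uw(1) by simp
    qed
    then show "U = ?V" using UV by blast
  qed
qed

text \<open>The normal elements of \<open>V (p * m)\<close> are the full preimage under
  \<open>T\<close> of those of \<open>V m\<close>.\<close>

lemma card_normal_step:
  "card {\<beta>. normal (p * m) \<beta>} = q ^ (p * m - m) * card {\<beta>. normal m \<beta>}"
proof -
  have n: "p * m > 0" using m p_pos by simp
  have "{\<beta>. normal (p * m) \<beta>} = {x \<in> V (p * m). T x \<in> {\<beta>. normal m \<beta>}}"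
    using normal_T_iff by (auto simp: normal_def)
  also have "card \<dots> = card {x \<in> V (p * m). T x = \<zero>} * card {\<beta>. normal m \<beta>}"
    by (rule card_additive_vimage)
      (use V_carrier card_V[OF n] T_add T_closed T_image in \<open>auto simp: normal_def\<close>)
  finally show ?thesis using T_card_ker by simp
qed

end

end

subsection \<open>Orbits of multiplication by \<open>q\<close> modulo \<open>n\<close>\<close>

text \<open>The \<open>q\<close>-cyclotomic coset of \<open>j\<close> modulo \<open>n\<close>.
  Nonnegative powers of \<open>q\<close> suffice for an orbit when \<open>q\<close> is invertible
  modulo \<open>n\<close>.\<close>

definition mult_orbit :: "nat \<Rightarrow> nat \<Rightarrow> nat \<Rightarrow> nat set" where
  "mult_orbit q n j = range (\<lambda>k. j * q ^ k mod n)"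

lemma mult_cong_iff_gcd:
  fixes j n a b :: nat
  assumes "n > 0"
  shows "[j * a = j * b] (mod n) \<longleftrightarrow> [a = b] (mod (n div gcd j n))"
proof -
  define g where "g = gcd j n"
  have g: "g > 0" using assms by (simp add: g_def)
  obtain j' n' where jn: "j = g * j'" "n = g * n'" "coprime j' n'"
    using gcd_coprime_exists[of j n] assms unfolding g_def by (metis gcd_nat.neutr_eq_iff gr_implies_not0 mult.commute)
  have "[j * a = j * b] (mod n) \<longleftrightarrow> [j' * a = j' * b] (mod n')"
    unfolding jn(1,2) mult.assoc using g by (simp add: cong_def mult_mod_right[symmetric])
  also have "\<dots> \<longleftrightarrow> [a = b] (mod n')" using jn(3) by (rule cong_mult_lcancel_nat)
  also have "n' = n div g" using jn g by simp
  finally show ?thesis by (simp add: g_def)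
qed

context
  fixes q n :: nat
  assumes n: "n > 0" and cop: "coprime n q"
begin

lemma coprime_div_gcd: "coprime (n div gcd j n) q"
  using cop by (metis coprime_divisors div_dvd_iff_mult dvd_refl dvd_triv_left gcd_dvd2 n gcd_pos_nat dvd_mult_div_cancel dvd_triv_right)

lemma mult_orbit_eq_iff:
  "j * q ^ k mod n = j * q ^ l mod n \<longleftrightarrow> [k = l] (mod ord (n div gcd j n) q)"
proof -
  have "j * q ^ k mod n = j * q ^ l mod n \<longleftrightarrow> [q ^ k = q ^ l] (mod (n div gcd j n))"
    using mult_cong_iff_gcd[OF n, of j "q ^ k" "q ^ l"] by (simp add: cong_def)
  also have "\<dots> \<longleftrightarrow> [k = l] (mod ord (n div gcd j n) q)"
    using order_divides_expdiff[OF coprime_div_gcd] .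
  finally show ?thesis .
qed

text \<open>The factor \<open>j\<close> may be cancelled at the price of the modulus
  \<open>n div gcd j n\<close>. The length thus depends only on the additive order of
  \<open>j\<close> modulo \<open>n\<close>, which allows the regrouping by divisors in
  \<open>prod_mult_orbits\<close>.\<close>

lemma card_mult_orbit: "card (mult_orbit q n j) = ord (n div gcd j n) q"
proof -
  define d where "d = ord (n div gcd j n) q"
  have d: "d > 0" unfolding d_def using coprime_div_gcd by simp
  have "j * q ^ k mod n = j * q ^ (k mod d) mod n" for k
    unfolding mult_orbit_eq_iff d_def[symmetric] by (simp add: cong_def)
  then have "mult_orbit q n j = (\<lambda>k. j * q ^ k mod n) ` {..<d}"
    unfolding mult_orbit_def using d by (auto intro!: image_eqI[of _ _ "_ mod d"])
  moreover have "inj_on (\<lambda>k. j * q ^ k mod n) {..<d}"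
    by (rule inj_onI) (simp add: mult_orbit_eq_iff d_def[symmetric] cong_def)
  ultimately show ?thesis by (simp add: card_image d_def)
qed

lemma mult_orbit_period: "j * q ^ card (mult_orbit q n j) mod n = j mod n"
  using mult_orbit_eq_iff[of j "card (mult_orbit q n j)" 0] unfolding card_mult_orbit by (simp add: cong_def)

lemma card_mult_orbit_pos: "card (mult_orbit q n j) > 0"
  unfolding card_mult_orbit using coprime_div_gcd by simp

lemma mult_orbit_subset: "mult_orbit q n j \<subseteq> {..<n}"
  using n by (auto simp: mult_orbit_def)

lemma mult_orbit_self: "j < n \<Longrightarrow> j \<in> mult_orbit q n j"
  by (auto simp: mult_orbit_def intro!: image_eqI[of _ _ 0])

lemma mult_orbit_eq:
  assumes "i \<in> mult_orbit q n j" shows "mult_orbit q n i = mult_orbit q n j"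
proof -
  have sub: "mult_orbit q n i \<subseteq> mult_orbit q n j" if ij: "i \<in> mult_orbit q n j" for i j
  proof
    fix y assume "y \<in> mult_orbit q n i"
    then obtain l where y: "y = i * q ^ l mod n" by (auto simp: mult_orbit_def)
    obtain k where "i = j * q ^ k mod n" using ij by (auto simp: mult_orbit_def)
    then have "y = j * q ^ (k + l) mod n" using y by (simp add: mod_mult_left_eq power_add mult.assoc)
    then show "y \<in> mult_orbit q n j" by (auto simp: mult_orbit_def)
  qed
  obtain k where k: "i = j * q ^ k mod n" using assms by (auto simp: mult_orbit_def)
  define d where "d = card (mult_orbit q n j)"
  have per: "j * q ^ (d * l) mod n = j mod n" for l
  proof (induction l)
    case (Suc l)
    have "j * q ^ (d * Suc l) mod n = (j * q ^ (d * l) mod n) * q ^ d mod n"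
      using mod_mult_left_eq[of "j * q ^ (d * l)" n "q ^ d"] by (simp add: power_add mult_ac)
    also have "\<dots> = j * q ^ d mod n" by (simp add: Suc mod_mult_left_eq)
    finally show ?case using mult_orbit_period[of j] by (simp add: d_def)
  qed simp
  have d: "d > 0" unfolding d_def by (rule card_mult_orbit_pos)
  have "mult_orbit q n j \<subseteq> mult_orbit q n i"
  proof
    fix y assume "y \<in> mult_orbit q n j"
    then obtain l where y: "y = j * q ^ l mod n" by (auto simp: mult_orbit_def)
    \<comment> \<open>The index \<open>i\<close> is \<open>k\<close> steps beyond \<open>j\<close>
      and the period is \<open>d\<close>; since \<open>d * k \<ge> k\<close>, another
      \<open>d * k - k\<close> steps complete whole turns and lead back to \<open>j\<close>.\<close>
    have "i * q ^ (d * k - k + l) mod n = j * q ^ (k + (d * k - k + l)) mod n"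
      unfolding k by (simp add: mod_mult_left_eq power_add mult.assoc)
    also have "k + (d * k - k + l) = d * k + l" using d by (cases d) auto
    also have "j * q ^ (d * k + l) mod n = (j * q ^ (d * k) mod n) * q ^ l mod n"
      by (simp add: mod_mult_left_eq power_add mult.assoc)
    also have "\<dots> = y" unfolding per y by (simp add: mod_mult_left_eq)
    finally show "y \<in> mult_orbit q n i" unfolding mult_orbit_def by blast
  qed
  then show ?thesis using sub[OF assms] by blast
qed

lemma mult_orbit_partition: "partition_on {..<n} (mult_orbit q n ` {..<n})"
proof (rule partition_onI)
  show "\<Union> (mult_orbit q n ` {..<n}) = {..<n}"
    using mult_orbit_subset mult_orbit_self by blast
  show "disjnt O1 O2" if "O1 \<in> mult_orbit q n ` {..<n}" "O2 \<in> mult_orbit q n ` {..<n}" "O1 \<noteq> O2" for O1 O2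
  proof (rule ccontr)
    assume "\<not> disjnt O1 O2"
    then obtain i where "i \<in> O1" "i \<in> O2" by (auto simp: disjnt_def)
    then have "O1 = mult_orbit q n i" "O2 = mult_orbit q n i"
      using that(1,2) mult_orbit_eq[of i] by (metis imageE)+
    then show False using that(3) by simp
  qed
  show "{} \<notin> mult_orbit q n ` {..<n}"
    by (auto simp: mult_orbit_def)
qed

text \<open>The factor of an orbit of length \<open>d\<close> is shared equally among its
  \<open>d\<close> elements as \<open>d\<close>-th roots. The elements are then regrouped by their
  additive order \<open>e\<close>, and \<open>totient e\<close> of them have order
  \<open>e\<close>.\<close>

lemma prod_mult_orbits:
  fixes g :: "nat \<Rightarrow> real"
  assumes g: "\<And>d. d > 0 \<Longrightarrow> g d > 0"
  shows "(\<Prod>B\<in>mult_orbit q n ` {..<n}. g (card B)) =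
    (\<Prod>e | e dvd n. g (ord e q) powr (real (totient e) / real (ord e q)))"
proof -
  let ?P = "mult_orbit q n ` {..<n}"
  let ?d = "\<lambda>j. ord (n div gcd j n) q"
  have "(\<Prod>B\<in>?P. g (card B)) = (\<Prod>B\<in>?P. \<Prod>j\<in>B. g (?d j) powr (1 / real (?d j)))"
  proof (rule prod.cong[OF refl])
    fix O1 assume O1: "O1 \<in> ?P"
    have dj: "?d j = card O1" if "j \<in> O1" for j
      using O1 that mult_orbit_eq card_mult_orbit by (metis (no_types, lifting) imageE)
    have pos: "card O1 > 0" using O1 card_mult_orbit_pos by auto
    have "(\<Prod>j\<in>O1. g (?d j) powr (1 / real (?d j))) = (\<Prod>j\<in>O1. g (card O1) powr (1 / real (card O1)))"
      using dj by (intro prod.cong) auto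
    also have "\<dots> = g (card O1)"
      using pos g[OF pos] by (simp add: powr_realpow[symmetric] powr_powr)
    finally show "g (card O1) = (\<Prod>j\<in>O1. g (?d j) powr (1 / real (?d j)))" ..
  qed
  also have "\<dots> = (\<Prod>j\<in>\<Union>?P. g (?d j) powr (1 / real (?d j)))"
  proof (rule prod.Union_disjoint[symmetric, unfolded o_apply])
    show "\<forall>A\<in>?P. finite A" using mult_orbit_subset finite_subset[of _ "{..<n}"] by auto
    show "\<forall>A\<in>?P. \<forall>B\<in>?P. A \<noteq> B \<longrightarrow> A \<inter> B = {}"
      using mult_orbit_partition by (auto simp only: partition_on_def disjoint_def)
  qed
  also have "\<Union>?P = {..<n}" using mult_orbit_partition by (simp add: partition_on_def)
  also have "(\<Prod>j<n. g (?d j) powr (1 / real (?d j))) =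
      (\<Prod>e | e dvd n. \<Prod>j | j < n \<and> n div gcd j n = e. g (?d j) powr (1 / real (?d j)))"
  proof -
    have "n div gcd j n dvd n" for j
      by (metis dvd_div_mult_self dvd_triv_left gcd_dvd2)
    then have "(\<lambda>j. n div gcd j n) ` {..<n} \<subseteq> {e. e dvd n}" by blast
    then show ?thesis
      using prod.group[of "{..<n}" "{e. e dvd n}" "\<lambda>j. n div gcd j n" "\<lambda>j. g (?d j) powr (1 / real (?d j))"] n
      by simp
  qed
  also have "\<dots> = (\<Prod>e | e dvd n. g (ord e q) powr (real (totient e) / real (ord e q)))"
  proof (rule prod.cong[OF refl])
    fix e assume "e \<in> {e. e dvd n}"
    then have e: "e dvd n" by simp
    \<comment> \<open>These \<open>j\<close> are the multiples \<open>g * i\<close> of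
      \<open>g = n / e\<close> with \<open>i < e\<close> coprime to \<open>e\<close>.\<close>
    have c: "card {j. j < n \<and> n div gcd j n = e} = totient e"
    proof -
      obtain g where ne: "n = e * g" using e by auto
      have g0: "g > 0" "e > 0" using ne n by auto
      have *: "n div gcd j n = e \<longleftrightarrow> gcd j n = g" for j
        using g0 unfolding ne by (metis dvd_mult_div_cancel gcd_dvd2 mult.commute nonzero_mult_div_cancel_left nonzero_mult_div_cancel_right less_irrefl mult_eq_0_iff)
      have "{j. j < n \<and> gcd j n = g} = (\<lambda>i. g * i) ` {i. i < e \<and> coprime i e}"
      proof (intro subset_antisym subsetI)
        fix j assume "j \<in> {j. j < n \<and> gcd j n = g}"
        then have j: "j < n" "gcd j n = g" by auto
        then obtain i where i: "j = g * i" by (metis dvd_def gcd_dvd1)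
        have "gcd (g * i) (g * e) = g" using j(2) i ne by (simp only: mult.commute)
        then have "g * gcd i e = g" by (simp only: gcd_mult_distrib_nat)
        then have "gcd i e = 1" using g0 by simp
        then have "coprime i e" by (simp only: coprime_iff_gcd_eq_1)
        moreover have "i < e" using j(1) i ne g0 by (simp only: mult.commute[of e g] nat_mult_less_cancel1)
        ultimately show "j \<in> (\<lambda>i. g * i) ` {i. i < e \<and> coprime i e}" using i by blast
      next
        fix j assume "j \<in> (\<lambda>i. g * i) ` {i. i < e \<and> coprime i e}"
        then obtain i where i: "j = g * i" "i < e" "coprime i e" by blast
        have "gcd j n = g * gcd i e" unfolding i ne mult.commute[of e g] by (rule gcd_mult_distrib_nat[symmetric])
        moreover have "j < n" using i(2) g0 unfolding i(1) ne mult.commute[of e g] by simp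
        ultimately show "j \<in> {j. j < n \<and> gcd j n = g}" using i(3) by simp
      qed
      then have "card {j. j < n \<and> gcd j n = g} = card {i. i < e \<and> coprime i e}"
        using g0 by (simp add: card_image inj_on_def)
      also have "\<dots> = card (totatives e)"
      \<comment> \<open>For \<open>e = 1\<close> the two sets differ: the residue counted is 0,
        while \<open>totatives\<close> contains 1 instead. The cardinalities still agree.\<close>
      proof (cases "e = 1")
        case True
        have "{i. i < (1::nat) \<and> coprime i (1::nat)} = {0}" by auto
        then show ?thesis using True by simp
      next
        case False
        have "{i. i < e \<and> coprime i e} = totatives e"
          using False g0 by (auto simp: in_totatives_iff intro!: gr0I le_neq_implies_less)
        then show ?thesis by simp
      qed
      finally show ?thesis by (simp add: * totient_def)
    qed
    have "(\<Prod>j | j < n \<and> n div gcd j n = e. g (?d j) powr (1 / real (?d j))) =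
      (\<Prod>j | j < n \<and> n div gcd j n = e. g (ord e q) powr (1 / real (ord e q)))"
      by (intro prod.cong) auto
    also have "\<dots> = g (ord e q) powr (real (totient e) / real (ord e q))"
    proof -
      have "ord e q > 0" using coprime_divisors[OF e dvd_refl cop] by simp
      then show ?thesis using g[of "ord e q"] by (simp add: c powr_realpow[symmetric] powr_powr)
    qed
    finally show "(\<Prod>j | j < n \<and> n div gcd j n = e. g (?d j) powr (1 / real (?d j))) =
      g (ord e q) powr (real (totient e) / real (ord e q))" .
  qed
  finally show ?thesis .
qed

end

subsection \<open>Normal elements through discrete Fourier coefficients\<close>

lemma (in abelian_group) finsum_swap:
  assumes "finite A" "finite B" "\<And>i j. i \<in> A \<Longrightarrow> j \<in> B \<Longrightarrow> g i j \<in> carrier G"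
  shows "(\<Oplus>i\<in>A. \<Oplus>j\<in>B. g i j) = (\<Oplus>j\<in>B. \<Oplus>i\<in>A. g i j)"
  using assms(1,3)
proof (induction A rule: finite_induct)
  case empty
  then show ?case by (simp add: finsum_zero)
next
  case (insert x A)
  have c: "(\<Oplus>j\<in>B. g x j) \<in> carrier G" by (rule finsum_closed) (use insert.prems in auto)
  have "(\<Oplus>i\<in>insert x A. \<Oplus>j\<in>B. g i j) = (\<Oplus>j\<in>B. g x j) \<oplus> (\<Oplus>i\<in>A. \<Oplus>j\<in>B. g i j)"
    by (rule finsum_insert) (use insert c in \<open>auto intro!: finsum_closed\<close>)
  also have "(\<Oplus>i\<in>A. \<Oplus>j\<in>B. g i j) = (\<Oplus>j\<in>B. \<Oplus>i\<in>A. g i j)"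
    using insert by blast
  also have "(\<Oplus>j\<in>B. g x j) \<oplus> \<dots> = (\<Oplus>j\<in>B. g x j \<oplus> (\<Oplus>i\<in>A. g i j))"
    by (rule finsum_addf[symmetric]) (use insert.prems in \<open>auto intro!: finsum_closed\<close>)
  also have "\<dots> = (\<Oplus>j\<in>B. \<Oplus>i\<in>insert x A. g i j)"
  proof (rule finsum_cong')
    fix j assume j: "j \<in> B"
    show "g x j \<oplus> (\<Oplus>i\<in>A. g i j) = (\<Oplus>i\<in>insert x A. g i j)"
      by (rule finsum_insert[symmetric]) (use insert j in auto)
  qed (use insert.prems in \<open>auto intro!: finsum_closed\<close>)
  finally show ?case .
qed

lemma (in abelian_group) finsum_shift:
  assumes f: "\<And>i. f i \<in> carrier G" and per: "f n = f (0::nat)"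
  shows "(\<Oplus>i\<in>{..<n}. f (Suc i)) = (\<Oplus>i\<in>{..<n}. f i)"
proof -
  have ins: "(\<Oplus>i\<in>{..<Suc m}. g i) = g m \<oplus> (\<Oplus>i\<in>{..<m}. g i)" if "\<And>i. g i \<in> carrier G" for g m
    unfolding lessThan_Suc by (rule finsum_insert) (use that in auto)
  have c: "(\<Oplus>i\<in>{..<m}. f i) \<in> carrier G" "(\<Oplus>i\<in>{..<m}. f (Suc i)) \<in> carrier G" for m
    using f by (auto intro!: finsum_closed)
  have "f 0 \<oplus> (\<Oplus>i\<in>{..<m}. f (Suc i)) = (\<Oplus>i\<in>{..<Suc m}. f i)" for m
  proof (induction m)
    case 0
    then show ?case using f by (simp add: lessThan_Suc)
  next
    case (Suc m)
    have "f 0 \<oplus> (\<Oplus>i\<in>{..<Suc m}. f (Suc i)) = f 0 \<oplus> (f (Suc m) \<oplus> (\<Oplus>i\<in>{..<m}. f (Suc i)))"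
      by (subst ins) (simp_all add: f)
    also have "\<dots> = f (Suc m) \<oplus> (f 0 \<oplus> (\<Oplus>i\<in>{..<m}. f (Suc i)))"
      by (rule a_lcomm) (use f c in auto)
    also have "\<dots> = f (Suc m) \<oplus> (\<Oplus>i\<in>{..<Suc m}. f i)" unfolding Suc ..
    also have "\<dots> = (\<Oplus>i\<in>{..<Suc (Suc m)}. f i)" by (rule ins[symmetric]) (rule f)
    finally show ?case .
  qed
  also have "(\<Oplus>i\<in>{..<Suc n}. f i) = f n \<oplus> (\<Oplus>i\<in>{..<n}. f i)" by (rule ins) (rule f)
  finally have "f 0 \<oplus> (\<Oplus>i\<in>{..<n}. f (Suc i)) = f 0 \<oplus> (\<Oplus>i\<in>{..<n}. f i)" unfolding per .
  then show ?thesis using add.l_cancel[of "f 0"] f c by blast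
qed

text \<open>Links list-based linear combinations with indexed sums, to which additive maps such as
  \<open>dft j\<close> can be applied termwise.\<close>

lemma (in ring) combine_map_upt:
  assumes "\<And>i. f i \<in> carrier R" "length Ks = n" "set Ks \<subseteq> carrier R"
  shows "combine Ks (map f [0..<n]) = (\<Oplus>i\<in>{..<n}. Ks ! i \<otimes> f i)"
  using assms(2,3)
proof (induction n arbitrary: Ks)
  case 0
  then show ?case by simp
next
  case (Suc n)
  obtain Ls k where Ks: "Ks = Ls @ [k]" using Suc.prems(1) by (cases Ks rule: rev_cases) auto
  have L: "length Ls = n" "set Ls \<subseteq> carrier R" "k \<in> carrier R" using Suc.prems Ks by auto
  have nth: "Ls ! i \<in> carrier R" if "i < n" for i using L that by (metis nth_mem subsetD)
  have "combine Ks (map f [0..<Suc n]) = combine (Ls @ [k]) (map f [0..<n] @ [f n])" using Ks by simp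
  also have "\<dots> = combine Ls (map f [0..<n]) \<oplus> combine [k] [f n]"
    by (rule combine_append[symmetric]) (use L assms(1) in auto)
  also have "\<dots> = (\<Oplus>i\<in>{..<n}. Ls ! i \<otimes> f i) \<oplus> k \<otimes> f n"
    using Suc.IH[OF L(1,2)] L assms(1) by simp
  also have "\<dots> = k \<otimes> f n \<oplus> (\<Oplus>i\<in>{..<n}. Ls ! i \<otimes> f i)"
    by (rule a_comm) (use nth L assms(1) in \<open>auto intro!: finsum_closed\<close>)
  also have "(\<Oplus>i\<in>{..<n}. Ls ! i \<otimes> f i) = (\<Oplus>i\<in>{..<n}. Ks ! i \<otimes> f i)"
    by (rule finsum_cong') (use nth L assms(1) in \<open>auto simp: Ks nth_append\<close>)
  also have "k \<otimes> f n = Ks ! n \<otimes> f n" using L Ks by (simp add: nth_append)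
  also have "Ks ! n \<otimes> f n \<oplus> (\<Oplus>i\<in>{..<n}. Ks ! i \<otimes> f i) = (\<Oplus>i\<in>{..<Suc n}. Ks ! i \<otimes> f i)"
    unfolding lessThan_Suc
    by (rule finsum_insert[symmetric]) (use nth L assms(1) in \<open>auto simp: Ks nth_append\<close>)
  finally show ?case .
qed

context frobenius_tower
begin

text \<open>Taking \<open>m = ord n q\<close> makes \<open>n\<close> divide
  \<open>q ^ m - 1\<close>, the order of the cyclic group of units of \<open>V m\<close>; a suitable
  power of a generator has order \<open>n\<close>.\<close>

lemma exists_primitive_root:
  assumes n: "n > 0" and cop: "coprime n q"
  obtains z where "z \<in> carrier L" "\<And>k::nat. z [^] k = \<one> \<longleftrightarrow> n dvd k"
proof -
  define m where "m = ord n q"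
  have m: "m > 0" using cop by (simp add: m_def)
  have "[q ^ m = 1] (mod n)" unfolding m_def by (rule ord)
  then have dvd: "n dvd q ^ m - 1" using cong_altdef_nat[of 1 "q ^ m" n] q_pow_pos[of m]
    by (metis One_nat_def Suc_leI cong_sym cong_to_1_nat)
  define F where "F = L\<lparr>carrier := V m\<rparr>"
  interpret F: field F unfolding F_def by (rule subfield_iff(2)[OF subfield_V])
  have finF: "finite (carrier F)" "card (carrier F) = q ^ m" using card_V[OF m] by (auto simp: F_def)
  interpret G: group "Multiplicative_Group.mult_of F" by (rule F.field_mult_group)
  obtain g where g: "g \<in> carrier (Multiplicative_Group.mult_of F)" "carrier (Multiplicative_Group.mult_of F) = {g [^]\<^bsub>F\<^esub> i | i::nat. i \<in> UNIV}"
    using F.finite_field_mult_group_has_gen[OF finF(1)] by blast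
  have finG: "finite (carrier (Multiplicative_Group.mult_of F))" using finF by simp
  have order: "card (carrier (Multiplicative_Group.mult_of F)) = q ^ m - 1"
    using F.order_mult_of[OF finF(1)] finF by (simp add: order_def)
  have "carrier (Multiplicative_Group.mult_of F) = {g [^]\<^bsub>Multiplicative_Group.mult_of F\<^esub> i | i. i \<in> {0 .. G.ord g - 1}}"
    using G.ord_elems[OF finG g(1)] g(2) by (simp add: Multiplicative_Group.nat_pow_mult_of)
  then have eq: "carrier (Multiplicative_Group.mult_of F) = (\<lambda>i. g [^]\<^bsub>Multiplicative_Group.mult_of F\<^esub> i) ` {0 .. G.ord g - 1}"
    unfolding Setcompr_eq_image .
  \<comment> \<open>All elements being powers of \<open>g\<close>, there are at most
    \<open>G.ord g\<close> of them, which forces the order of \<open>g\<close> to be the full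
    \<open>q ^ m - 1\<close>.\<close>
  have "card (carrier (Multiplicative_Group.mult_of F)) \<le> card {0 .. G.ord g - 1}"
    unfolding eq by (rule card_image_le) simp
  moreover have "G.ord g \<ge> 1" using G.ord_ge_1[OF finG g(1)] .
  moreover have "G.ord g \<le> q ^ m - 1" using G.ord_le_group_order[OF finG g(1)] order unfolding order_def by (simp only:)
  ultimately have "G.ord g = q ^ m - 1" using order by simp
  then have gp: "g [^]\<^bsub>Multiplicative_Group.mult_of F\<^esub> k = \<one>\<^bsub>Multiplicative_Group.mult_of F\<^esub> \<longleftrightarrow> q ^ m - 1 dvd k" for k :: nat
    using G.pow_eq_id[OF g(1), of k] by simp
  have pow: "x [^]\<^bsub>Multiplicative_Group.mult_of F\<^esub> k = x [^] k" for x and k :: nat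
    unfolding Multiplicative_Group.nat_pow_mult_of F_def nat_pow_def by simp
  have gL: "g \<in> carrier L" using g(1) V_carrier by (auto simp: F_def)
  define z where "z = g [^] ((q ^ m - 1) div n)"
  show thesis
  proof
    show "z \<in> carrier L" unfolding z_def using gL by simp
    fix k :: nat
    have M: "q ^ m - 1 > 0" using one_less_power[OF q_gt_1 m] by simp
    have "z [^] k = g [^] ((q ^ m - 1) div n * k)" unfolding z_def using gL by (simp add: nat_pow_pow)
    then have "z [^] k = \<one> \<longleftrightarrow> q ^ m - 1 dvd (q ^ m - 1) div n * k"
      using gp[of "(q ^ m - 1) div n * k"] unfolding pow by (simp add: F_def)
    also have "\<dots> \<longleftrightarrow> n dvd k"
    proof -
      obtain c where c: "q ^ m - 1 = n * c" using dvd by auto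
      then have "c > 0" using M by auto
      then show ?thesis unfolding c using n by simp
    qed
    finally show "z [^] k = \<one> \<longleftrightarrow> n dvd k" .
  qed
qed

text \<open>Dividing by one nonzero solution turns the others into elements of \<open>V d\<close>.
  Only an upper bound is proved; \<open>card_normal_coprime\<close> shows by counting that it is
  attained for the constants arising there.\<close>

lemma card_twisted_fixed:
  assumes c: "c \<in> carrier L" "c \<noteq> \<zero>" and d: "d > 0"
  defines "S \<equiv> {y \<in> carrier L. y = c \<otimes> y [^] (q ^ d)}"
  shows "finite S" "card S \<le> q ^ d" "\<zero> \<in> S"
proof -
  show z: "\<zero> \<in> S" using c by (simp add: S_def)
  have "finite S \<and> card S \<le> q ^ d"
  proof (cases "S = {\<zero>}")
    case True
    then show ?thesis using q_gt_1 by simp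
  next
    case False
    then obtain y0 where y0: "y0 \<in> S" "y0 \<noteq> \<zero>" using z by auto
    then have y0L: "y0 \<in> carrier L" "y0 \<in> Units L" using field_Units by (auto simp: S_def)
    define u where "u = inv y0"
    have u: "u \<in> carrier L" "y0 \<otimes> u = \<one>" using y0L by (auto simp: u_def)
    have u0: "u \<noteq> \<zero>" using u y0L by auto
    have one: "y0 [^] (q ^ d) \<otimes> u [^] (q ^ d) = \<one>"
      using u y0L nat_pow_distrib[of y0 u "q ^ d"] by simp
    have uQ: "u [^] (q ^ d) = c \<otimes> u"
    proof -
      have "c \<otimes> u = c \<otimes> u \<otimes> (y0 [^] (q ^ d) \<otimes> u [^] (q ^ d))" using one u c by simp
      also have "\<dots> = (c \<otimes> y0 [^] (q ^ d)) \<otimes> u \<otimes> u [^] (q ^ d)"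
        using c u y0L by (simp add: m_ac)
      also have "c \<otimes> y0 [^] (q ^ d) = y0" using y0(1) by (simp add: S_def)
      finally show ?thesis using u by simp
    qed
    have "(\<lambda>y. y \<otimes> u) ` S \<subseteq> V d"
    proof
      fix w assume "w \<in> (\<lambda>y. y \<otimes> u) ` S"
      then obtain y where y: "y \<in> carrier L" "y = c \<otimes> y [^] (q ^ d)" "w = y \<otimes> u" by (auto simp: S_def)
      have "w [^] (q ^ d) = y [^] (q ^ d) \<otimes> (c \<otimes> u)"
        unfolding y(3) using y u uQ by (simp add: nat_pow_distrib)
      also have "\<dots> = (c \<otimes> y [^] (q ^ d)) \<otimes> u" using y(1) c u by (simp add: m_ac)
      finally show "w \<in> V d" using y u by (simp add: V_def)
    qed
    moreover have "inj_on (\<lambda>y. y \<otimes> u) S"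
      using u u0 by (auto intro!: inj_onI simp: S_def m_rcancel)
    ultimately show ?thesis using card_V[OF d] card_inj_on_le[of "\<lambda>y. y \<otimes> u" S "V d"] inj_on_finite by metis
  qed
  then show "finite S" "card S \<le> q ^ d" by auto
qed

end

lemma (in cring) add_pow_eq_mult: "x \<in> carrier R \<Longrightarrow> [(k::nat)] \<cdot> x = ([k] \<cdot> \<one>) \<otimes> x"
  using add_pow_ldistr[of \<one> x k] by simp

lemma (in domain) nat_pow_nonzero: "x \<in> carrier R \<Longrightarrow> x \<noteq> \<zero> \<Longrightarrow> x [^] (k::nat) \<noteq> \<zero>"
  by (induction k) (auto simp: integral_iff)

locale frobenius_tower_root = frobenius_tower +
  fixes n :: nat and z
  assumes n_pos: "n > 0" and cop: "coprime n q"
    and z [simp]: "z \<in> carrier L" and z_iff: "\<And>k::nat. z [^] k = \<one> \<longleftrightarrow> n dvd k"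
begin

lemma z_pow_n: "z [^] n = \<one>"
  using z_iff[of n] by simp

lemma z_cong:
  assumes "[i = j] (mod n)" shows "z [^] i = z [^] j"
proof -
  have "z [^] k = z [^] (k mod n)" for k :: nat
  proof -
    have "z [^] k = z [^] (n * (k div n) + k mod n)" by simp
    also have "\<dots> = (z [^] n) [^] (k div n) \<otimes> z [^] (k mod n)"
      by (simp only: nat_pow_mult[symmetric] nat_pow_pow z)
    finally show ?thesis by (simp add: z_pow_n)
  qed
  then show ?thesis using assms unfolding cong_def by metis
qed

lemma z_pow_nonzero: "z [^] (i::nat) \<noteq> \<zero>"
proof
  assume "z [^] i = \<zero>"
  moreover have "z [^] (i * n) = \<one>" using z_iff by simp
  moreover have "z [^] (i * n) = (z [^] i) [^] n" by (simp add: nat_pow_pow)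
  ultimately show False using n_pos nat_pow_zero[of n] by simp
qed

text \<open>\<open>n\<close> is coprime to \<open>p\<close>, so by Bezout \<open>n = 0\<close> in
  \<open>L\<close> would give \<open>1 = 0\<close>. Invertibility of \<open>n\<close> is what
  permits Fourier inversion.\<close>

lemma n_unit: "[n] \<cdot> \<one> \<noteq> \<zero>"
proof
  assume n0: "[n] \<cdot> \<one> = \<zero>"
  have "coprime n p" using cop a_pos by (simp add: q_eq)
  then obtain x l where kl: "n * x = p * l + 1"
    using bezout_nat[of n p] n_pos by auto
  have z: "[(m * k)] \<cdot> \<one> = \<zero>" if "[m] \<cdot> \<one> = \<zero>" for m k :: nat
    using that add.nat_pow_pow[OF one_closed, of k m] by (simp add: mult.commute)
  have "[(n * x)] \<cdot> \<one> = \<zero>" using z[OF n0, of x] .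
  moreover have "[(p * l + 1)] \<cdot> \<one> = \<one>"
    using z[OF char, of l] by simp
  ultimately show False using kl by simp
qed

text \<open>Orthogonality of characters: multiplication by \<open>z ^ i\<close> permutes the terms
  cyclically, so the sum vanishes unless \<open>z ^ i = 1\<close>.\<close>

lemma geometric_sum: "(\<Oplus>j\<in>{..<n}. z [^] (j * i)) = (if n dvd i then [n] \<cdot> \<one> else \<zero>)"
proof (cases "n dvd i")
  case True
  then have "z [^] (j * i) = \<one>" for j using z_iff by simp
  then have "(\<Oplus>j\<in>{..<n}. z [^] (j * i)) = (\<Oplus>j\<in>{..<n}. \<one>)" by simp
  also have "\<dots> = [n] \<cdot> \<one>" using add.finprod_const[OF one_closed, of "{..<n}"] by simp
  finally show ?thesis using True by simp
next
  case False
  define S where "S = (\<Oplus>j\<in>{..<n}. z [^] (j * i))"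
  have S: "S \<in> carrier L" unfolding S_def by (rule finsum_closed) simp
  have "z [^] i \<otimes> S = (\<Oplus>j\<in>{..<n}. z [^] i \<otimes> z [^] (j * i))"
    unfolding S_def by (rule finsum_rdistr) simp_all
  also have "\<dots> = (\<Oplus>j\<in>{..<n}. z [^] (Suc j * i))" by (simp add: nat_pow_mult)
  also have "\<dots> = S" unfolding S_def by (rule finsum_shift) (use z_iff[of "n * i"] in simp_all)
  finally have "z [^] i \<otimes> S = \<one> \<otimes> S" using S by simp
  moreover have "z [^] i \<noteq> \<one>" using False z_iff by simp
  ultimately have "S = \<zero>" using S m_rcancel[of S "z [^] i" \<one>] by auto
  then show ?thesis using False by (simp add: S_def)
qed

text \<open>The discrete Fourier transform of the sequence of conjugates of \<open>x\<close>. Its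
  values lie in \<open>L\<close>, since \<open>z\<close> need not belong to
  \<open>V n\<close>.\<close>

definition dft :: "nat \<Rightarrow> 'a \<Rightarrow> 'a" where
  "dft j x = (\<Oplus>i\<in>{..<n}. z [^] (i * j) \<otimes> x [^] (q ^ i))"

lemma dft_closed: "x \<in> carrier L \<Longrightarrow> dft j x \<in> carrier L"
  unfolding dft_def by (rule finsum_closed) simp

lemma dft_add:
  assumes "x \<in> carrier L" "y \<in> carrier L" shows "dft j (x \<oplus> y) = dft j x \<oplus> dft j y"
proof -
  have "dft j (x \<oplus> y) = (\<Oplus>i\<in>{..<n}. z [^] (i * j) \<otimes> x [^] (q ^ i) \<oplus> z [^] (i * j) \<otimes> y [^] (q ^ i))"
    unfolding dft_def using assms by (simp add: frob_add r_distr)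
  also have "\<dots> = dft j x \<oplus> dft j y"
    unfolding dft_def by (rule finsum_addf) (use assms in simp_all)
  finally show ?thesis .
qed

lemma dft_smult:
  assumes "x \<in> carrier L" "c \<in> V 1" shows "dft j (c \<otimes> x) = c \<otimes> dft j x"
proof -
  have c: "c \<in> carrier L" using assms V_carrier by auto
  have "c \<otimes> dft j x = (\<Oplus>i\<in>{..<n}. c \<otimes> (z [^] (i * j) \<otimes> x [^] (q ^ i)))"
    unfolding dft_def by (rule finsum_rdistr) (use assms c in simp_all)
  also have "\<dots> = dft j (c \<otimes> x)"
    unfolding dft_def
    by (rule finsum_cong') (use assms c in \<open>simp_all add: nat_pow_distrib V1_fixed m_lcomm\<close>)
  finally show ?thesis ..
qed

lemma dft_cong: "[i = j] (mod n) \<Longrightarrow> dft i x = dft j x"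
  unfolding dft_def using z_cong[OF cong_mult[OF cong_refl]] by simp

text \<open>Frobenius shifts the sequence of conjugates by one place, cyclically on
  \<open>V n\<close>. Hence \<open>dft j\<close> is an eigenvector for Frobenius, with eigenvalue
  the inverse of \<open>z ^ j\<close>.\<close>

lemma dft_frob_shift:
  assumes "x \<in> V n" shows "z [^] j \<otimes> dft j (x [^] q) = dft j x"
proof -
  have x: "x \<in> carrier L" using assms V_carrier by auto
  have "z [^] j \<otimes> dft j (x [^] q) = (\<Oplus>i\<in>{..<n}. z [^] j \<otimes> (z [^] (i * j) \<otimes> (x [^] q) [^] (q ^ i)))"
    unfolding dft_def by (rule finsum_rdistr) (use x in simp_all)
  also have "\<dots> = (\<Oplus>i\<in>{..<n}. z [^] (Suc i * j) \<otimes> x [^] (q ^ Suc i))"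
    by (rule finsum_cong') (use x in \<open>simp_all add: m_assoc[symmetric] nat_pow_mult nat_pow_pow\<close>)
  also have "\<dots> = dft j x"
    unfolding dft_def
    by (rule finsum_shift) (use x z_iff[of "n * j"] V_fixed[OF assms] in simp_all)
  finally show ?thesis .
qed

lemma dft_frob_pow:
  assumes "x \<in> V n" shows "z [^] (k * j) \<otimes> dft j (x [^] (q ^ k)) = dft j x"
proof (induction k)
  case 0
  then show ?case using assms V_carrier dft_closed by simp
next
  case (Suc k)
  have x: "x \<in> carrier L" using assms V_carrier by auto
  have "z [^] (Suc k * j) \<otimes> dft j (x [^] (q ^ Suc k)) =
      z [^] (k * j) \<otimes> (z [^] j \<otimes> dft j ((x [^] (q ^ k)) [^] q))"
    using x dft_closed by (simp add: m_assoc[symmetric] nat_pow_mult nat_pow_pow add.commute mult.commute)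
  also have "\<dots> = z [^] (k * j) \<otimes> dft j (x [^] (q ^ k))"
    using dft_frob_shift[of "x [^] (q ^ k)" j] assms by simp
  finally show ?case using Suc by simp
qed

text \<open>Raising the whole sum to the power \<open>q\<close> turns it into the coefficient of
  \<open>x ^ q\<close> at index \<open>j * q\<close>, and the shift then restores \<open>x\<close>.
  Hence the coefficients along an orbit of multiplication by \<open>q\<close> determine one
  another.\<close>

lemma dft_mult_q:
  assumes "x \<in> V n" shows "dft (j * q) x = z [^] (j * q) \<otimes> (dft j x) [^] q"
proof -
  have x: "x \<in> carrier L" using assms V_carrier by auto
  have "(dft j x) [^] q = (\<Oplus>i\<in>{..<n}. (z [^] (i * j) \<otimes> x [^] (q ^ i)) [^] q)"
    unfolding dft_def using frob_finsum[of "\<lambda>i. z [^] (i * j) \<otimes> x [^] (q ^ i)" "{..<n}" 1] x by simp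
  also have "\<dots> = dft (j * q) (x [^] q)"
    unfolding dft_def
    by (rule finsum_cong') (use x in \<open>simp_all add: nat_pow_distrib nat_pow_pow mult_ac\<close>)
  finally show ?thesis using dft_frob_shift[OF assms, of "j * q"] by simp
qed

text \<open>One constant \<open>c\<close> serves every \<open>x\<close>, so that equality of two
  coefficients at one index passes to the whole orbit.\<close>

lemma dft_mult_q_pow:
  "\<exists>c\<in>carrier L - {\<zero>}. \<forall>x\<in>V n. dft (j * q ^ k) x = c \<otimes> (dft j x) [^] (q ^ k)"
proof (induction k)
  case 0
  have "\<forall>x\<in>V n. dft (j * q ^ 0) x = \<one> \<otimes> (dft j x) [^] (q ^ 0)"
    using V_carrier dft_closed by simp
  then show ?case by (intro bexI[of _ \<one>]) auto
next
  case (Suc k)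
  then obtain c where c: "c \<in> carrier L" "c \<noteq> \<zero>"
    and *: "\<And>x. x \<in> V n \<Longrightarrow> dft (j * q ^ k) x = c \<otimes> (dft j x) [^] (q ^ k)" by blast
  let ?c = "z [^] (j * q ^ k * q) \<otimes> c [^] q"
  have "dft (j * q ^ Suc k) x = ?c \<otimes> (dft j x) [^] (q ^ Suc k)" if x: "x \<in> V n" for x
  proof -
    have xL: "dft j x \<in> carrier L" using x V_carrier dft_closed by auto
    have "dft (j * q ^ Suc k) x = dft (j * q ^ k * q) x" by (simp add: mult_ac)
    also have "\<dots> = z [^] (j * q ^ k * q) \<otimes> (c \<otimes> (dft j x) [^] (q ^ k)) [^] q"
      unfolding dft_mult_q[OF x] *[OF x] ..
    also have "\<dots> = ?c \<otimes> (dft j x) [^] (q ^ Suc k)"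
      using c xL by (simp add: nat_pow_distrib nat_pow_pow m_assoc mult.commute)
    finally show ?thesis .
  qed
  moreover have "?c \<in> carrier L - {\<zero>}"
  proof -
    have "c [^] q \<noteq> \<zero>" using c by (rule nat_pow_nonzero)
    then show ?thesis using c z_pow_nonzero integral_iff by auto
  qed
  ultimately show ?case by blast
qed

text \<open>Fourier inversion at place 0: by orthogonality only the conjugate with
  \<open>i = 0\<close> survives. As \<open>n\<close> is invertible in \<open>L\<close>, this already
  gives injectivity (\<open>dft_inj\<close>).\<close>

lemma sum_dft:
  assumes "x \<in> carrier L" shows "(\<Oplus>j\<in>{..<n}. dft j x) = [n] \<cdot> x"
proof -
  have "(\<Oplus>j\<in>{..<n}. dft j x) = (\<Oplus>i\<in>{..<n}. \<Oplus>j\<in>{..<n}. z [^] (i * j) \<otimes> x [^] (q ^ i))"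
    unfolding dft_def by (rule finsum_swap) (use assms in simp_all)
  also have "\<dots> = (\<Oplus>i\<in>{..<n}. if 0 = i then [n] \<cdot> x else \<zero>)"
  proof (rule finsum_cong')
    fix i assume i: "i \<in> {..<n}"
    have "(\<Oplus>j\<in>{..<n}. z [^] (i * j) \<otimes> x [^] (q ^ i)) = (\<Oplus>j\<in>{..<n}. z [^] (j * i)) \<otimes> x [^] (q ^ i)"
      by (subst finsum_ldistr) (use assms in \<open>simp_all add: mult.commute\<close>)
    also have "\<dots> = (if 0 = i then [n] \<cdot> x else \<zero>)"
      unfolding geometric_sum using i assms add_pow_eq_mult[OF assms, of n] by (auto dest: dvd_imp_le)
    finally show "(\<Oplus>j\<in>{..<n}. z [^] (i * j) \<otimes> x [^] (q ^ i)) = (if 0 = i then [n] \<cdot> x else \<zero>)" .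
  qed (use assms in auto)
  also have "\<dots> = [n] \<cdot> x"
    using add.finprod_singleton[of 0 "{..<n}" "\<lambda>_. [n] \<cdot> x"] n_pos assms by simp
  finally show ?thesis .
qed

lemma dft_inj:
  assumes x: "x \<in> carrier L" and y: "y \<in> carrier L" and eq: "\<And>j. j < n \<Longrightarrow> dft j x = dft j y"
  shows "x = y"
proof -
  have "(\<Oplus>j\<in>{..<n}. dft j x) = (\<Oplus>j\<in>{..<n}. dft j y)"
    by (rule finsum_cong') (use eq y dft_closed in auto)
  then have "([n] \<cdot> \<one>) \<otimes> x = ([n] \<cdot> \<one>) \<otimes> y"
    unfolding sum_dft[OF x] sum_dft[OF y] add_pow_eq_mult[OF x, of n] add_pow_eq_mult[OF y, of n] .
  then show ?thesis using n_unit x y m_lcancel[of "[n] \<cdot> \<one>" x y] by simp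
qed

text \<open>Apply \<open>dft j\<close> to a linear relation with coefficients \<open>c k\<close>.
  Being an eigenvector for Frobenius that does not vanish at \<open>\<beta>\<close>, it leaves the
  vanishing of the Fourier transform of \<open>c\<close> at \<open>j\<close>. This holds for all
  \<open>j\<close>, and inversion gives \<open>c = 0\<close>.\<close>

lemma independent_conj:
  assumes \<beta>: "\<beta> \<in> V n" and nz: "\<And>j. j < n \<Longrightarrow> dft j \<beta> \<noteq> \<zero>"
  shows "independent (V 1) (conj n \<beta>)"
proof (rule ccontr)
  have \<beta>L: "\<beta> \<in> carrier L" using \<beta> V_carrier by auto
  assume "dependent (V 1) (conj n \<beta>)"
  then obtain Ks where Ks: "length Ks = length (conj n \<beta>)" "combine Ks (conj n \<beta>) = \<zero>"
      "set Ks \<subseteq> V 1" "set Ks \<noteq> {\<zero>}"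
    using dependent_imp_non_trivial_combine[OF subfield_V conj_carrier[OF \<beta>L]] by blast
  have len: "length Ks = n" using Ks(1) by (simp add: conj_def)
  define c where "c k = (if k < n then Ks ! k else \<zero>)" for k
  have cV: "c k \<in> V 1" for k using Ks(3) len by (auto simp: c_def)
  then have cL: "c k \<in> carrier L" for k using V_carrier by blast
  have KsL: "set Ks \<subseteq> carrier L" using Ks(3) V_carrier by blast
  have comb: "(\<Oplus>k\<in>{..<n}. c k \<otimes> \<beta> [^] (q ^ k)) = \<zero>"
  proof -
    have "(\<Oplus>k\<in>{..<n}. c k \<otimes> \<beta> [^] (q ^ k)) = (\<Oplus>k\<in>{..<n}. Ks ! k \<otimes> \<beta> [^] (q ^ k))"
      by (rule finsum_cong') (use cL \<beta>L KsL len nth_mem in \<open>auto simp: c_def subset_iff\<close>)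
    also have "\<dots> = combine Ks (conj n \<beta>)"
      unfolding conj_def by (rule combine_map_upt[symmetric]) (use \<beta>L len KsL in auto)
    finally show ?thesis using Ks(2) by simp
  qed
  \<comment> \<open>\<open>w\<close> is the inverse of \<open>z\<close>, written as a power of
    \<open>z\<close> so that exponents stay natural numbers.\<close>
  define w where "w = z [^] (n - 1)"
  have w: "w \<in> carrier L" by (simp add: w_def)
  have wz: "w [^] i \<otimes> z [^] i = \<one>" for i :: nat
  proof -
    have "w \<otimes> z = \<one>" unfolding w_def using n_pos z_pow_n nat_pow_Suc[of z "n - 1"] by simp
    then show ?thesis using nat_pow_distrib[of w z i] w by simp
  qed
  have char_zero: "(\<Oplus>k\<in>{..<n}. c k \<otimes> w [^] (k * j)) = \<zero>" if j: "j < n" for j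
  proof -
    let ?D = "dft j \<beta>"
    have D: "?D \<in> carrier L" using dft_closed[OF \<beta>L] .
    have conj: "dft j (\<beta> [^] (q ^ k)) = w [^] (k * j) \<otimes> ?D" for k
    proof -
      have "w [^] (k * j) \<otimes> ?D = w [^] (k * j) \<otimes> (z [^] (k * j) \<otimes> dft j (\<beta> [^] (q ^ k)))"
        using dft_frob_pow[OF \<beta>] by simp
      also have "\<dots> = (w [^] (k * j) \<otimes> z [^] (k * j)) \<otimes> dft j (\<beta> [^] (q ^ k))"
        by (rule m_assoc[symmetric]) (use w dft_closed \<beta>L in auto)
      finally show ?thesis using wz dft_closed \<beta>L by simp
    qed
    have "\<zero> = dft j (\<Oplus>k\<in>{..<n}. c k \<otimes> \<beta> [^] (q ^ k))"
      unfolding comb using dft_smult[OF zero_closed, of \<zero> j] dft_closed by simp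
    also have "\<dots> = (\<Oplus>k\<in>{..<n}. dft j (c k \<otimes> \<beta> [^] (q ^ k)))"
      by (rule additive_finsum) (use dft_closed dft_add cL \<beta>L in auto)
    also have "\<dots> = (\<Oplus>k\<in>{..<n}. (c k \<otimes> w [^] (k * j)) \<otimes> ?D)"
      by (rule finsum_cong') (use cV cL \<beta>L w D in \<open>auto simp: dft_smult conj m_assoc\<close>)
    also have "\<dots> = (\<Oplus>k\<in>{..<n}. c k \<otimes> w [^] (k * j)) \<otimes> ?D"
      by (rule finsum_ldistr[symmetric]) (use cL w D in auto)
    finally have "(\<Oplus>k\<in>{..<n}. c k \<otimes> w [^] (k * j)) \<otimes> ?D = \<zero>" ..
    moreover have "(\<Oplus>k\<in>{..<n}. c k \<otimes> w [^] (k * j)) \<in> carrier L"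
      by (rule finsum_closed) (use cL w in auto)
    ultimately show ?thesis using integral[of _ ?D] D nz[OF j] by blast
  qed
  have "c l = \<zero>" if l: "l < n" for l
  proof -
    have "\<zero> = (\<Oplus>j\<in>{..<n}. z [^] (j * l) \<otimes> (\<Oplus>k\<in>{..<n}. c k \<otimes> w [^] (k * j)))"
      using char_zero by (subst finsum_cong'[of _ _ "\<lambda>_. \<zero>"]) (auto simp: finsum_zero)
    also have "\<dots> = (\<Oplus>j\<in>{..<n}. \<Oplus>k\<in>{..<n}. z [^] (j * l) \<otimes> (c k \<otimes> w [^] (k * j)))"
      by (rule finsum_cong') (use cL w in \<open>auto intro!: finsum_rdistr finsum_closed\<close>)
    also have "\<dots> = (\<Oplus>k\<in>{..<n}. \<Oplus>j\<in>{..<n}. z [^] (j * l) \<otimes> (c k \<otimes> w [^] (k * j)))"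
      by (rule finsum_swap) (use cL w in auto)
    also have "\<dots> = (\<Oplus>k\<in>{..<n}. if l = k then c k \<otimes> ([n] \<cdot> \<one>) else \<zero>)"
    proof (rule finsum_cong')
      fix k assume k: "k \<in> {..<n}"
      have "z [^] (j * l) \<otimes> (c k \<otimes> w [^] (k * j)) = c k \<otimes> z [^] (j * (l + (n - 1) * k))" for j
      proof -
        have "z [^] (j * (l + (n - 1) * k)) = z [^] (j * l) \<otimes> w [^] (k * j)"
          unfolding w_def by (simp add: nat_pow_pow nat_pow_mult distrib_left mult_ac)
        then show ?thesis using cL w by (simp add: m_lcomm)
      qed
      then have "(\<Oplus>j\<in>{..<n}. z [^] (j * l) \<otimes> (c k \<otimes> w [^] (k * j))) =
          (\<Oplus>j\<in>{..<n}. c k \<otimes> z [^] (j * (l + (n - 1) * k)))" by simp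
      also have "\<dots> = c k \<otimes> (\<Oplus>j\<in>{..<n}. z [^] (j * (l + (n - 1) * k)))"
        by (rule finsum_rdistr[symmetric]) (use cL in auto)
      \<comment> \<open>With \<open>w = z ^ (n - 1)\<close> the exponent
        \<open>l + (n - 1) * k\<close> stands for \<open>l - k\<close> modulo
        \<open>n\<close>.\<close>
      also have "n dvd l + (n - 1) * k \<longleftrightarrow> l = k"
      proof -
        have "(l + (n - 1) * k) + k = l + n * k" using n_pos by (cases n) auto
        then have "n dvd l + (n - 1) * k \<longleftrightarrow> [l = k] (mod n)"
          by (metis cong_0_iff cong_add_rcancel_nat cong_def mod_mult_self2 add_0)
        then show ?thesis using l k by (simp add: cong_def)
      qed
      then have "c k \<otimes> (\<Oplus>j\<in>{..<n}. z [^] (j * (l + (n - 1) * k))) = (if l = k then c k \<otimes> ([n] \<cdot> \<one>) else \<zero>)"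
        unfolding geometric_sum using cL by simp
      finally show "(\<Oplus>j\<in>{..<n}. z [^] (j * l) \<otimes> (c k \<otimes> w [^] (k * j))) = (if l = k then c k \<otimes> ([n] \<cdot> \<one>) else \<zero>)" .
    qed (use cL in auto)
    also have "\<dots> = c l \<otimes> ([n] \<cdot> \<one>)"
      using add.finprod_singleton[of l "{..<n}" "\<lambda>k. c k \<otimes> ([n] \<cdot> \<one>)"] l cL by simp
    finally have "c l \<otimes> ([n] \<cdot> \<one>) = \<zero>" ..
    then show ?thesis using integral[of "c l" "[n] \<cdot> \<one>"] cL n_unit by simp
  qed
  then have "Ks ! k = \<zero>" if "k < n" for k using that by (metis c_def)
  then have "set Ks \<subseteq> {\<zero>}" using len by (auto simp: in_set_conv_nth)
  moreover have "Ks \<noteq> []" using len n_pos by auto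
  ultimately show False using Ks(4) by (cases Ks) auto
qed

end

text \<open>Lets a comparison of total counts force equality in every factor; positivity excludes a
  zero factor that would hide a strict inequality elsewhere.\<close>

lemma prod_eq_imp_eq:
  fixes f g :: "'b \<Rightarrow> nat"
  assumes "finite A" "\<And>x. x \<in> A \<Longrightarrow> f x \<le> g x" "prod f A = prod g A" "prod g A > 0" "x \<in> A"
  shows "f x = g x"
proof (rule ccontr)
  assume "f x \<noteq> g x"
  then have lt: "f x < g x" using assms(2)[OF assms(5)] by simp
  have g: "prod g A = g x * prod g (A - {x})" and f: "prod f A = f x * prod f (A - {x})"
    using assms(1,5) by (simp_all add: prod.remove)
  have "prod f (A - {x}) \<le> prod g (A - {x})" using assms(2) by (intro prod_mono) auto
  then have "f x * prod f (A - {x}) \<le> f x * prod g (A - {x})" by simp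
  also have "\<dots> < g x * prod g (A - {x})" using lt assms(4) g by (intro mult_less_mono1) auto
  finally show False using assms(3) f g by simp
qed

context frobenius_tower_root
begin

abbreviation "orbits \<equiv> mult_orbit q n ` {..<n}"

text \<open>Choosing a representative index \<open>r B\<close> in each orbit maps \<open>V n\<close>
  injectively into a product of sets \<open>S B\<close> of at most \<open>q ^ card B\<close>
  elements. The orbit sizes add up to \<open>n\<close>, so counting makes this map bijective. Normal
  elements correspond to the points with no zero coordinate.\<close>

lemma card_normal_coprime: "card {\<beta>. normal n \<beta>} = (\<Prod>B\<in>orbits. q ^ card B - 1)"
proof -
  have fin: "finite orbits" by simp
  have "\<exists>j. j < n \<and> B = mult_orbit q n j" if "B \<in> orbits" for B using that by auto
  then obtain r where r: "\<And>B. B \<in> orbits \<Longrightarrow> r B < n" "\<And>B. B \<in> orbits \<Longrightarrow> B = mult_orbit q n (r B)"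
    by metis
  have card_pos: "card B > 0" if "B \<in> orbits" for B
    using r(2)[OF that] card_mult_orbit_pos[OF n_pos cop] by metis
  \<comment> \<open>Going once around the orbit returns to the index \<open>r B\<close> modulo
    \<open>n\<close>, so the coefficient there satisfies a twisted fixed point equation.\<close>
  have "\<exists>c\<in>carrier L - {\<zero>}. \<forall>x\<in>V n. dft (r B) x = c \<otimes> (dft (r B) x) [^] (q ^ card B)" if "B \<in> orbits" for B
  proof -
    have "[r B * q ^ card B = r B] (mod n)"
      using mult_orbit_period[OF n_pos cop, of "r B"] r(2)[OF that] by (simp add: cong_def)
    then show ?thesis using dft_mult_q_pow[of "r B" "card B"] dft_cong by metis
  qed
  then obtain c where c: "\<And>B. B \<in> orbits \<Longrightarrow> c B \<in> carrier L - {\<zero>}"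
    "\<And>B x. B \<in> orbits \<Longrightarrow> x \<in> V n \<Longrightarrow> dft (r B) x = c B \<otimes> (dft (r B) x) [^] (q ^ card B)"
    by metis
  define S where "S B = {y \<in> carrier L. y = c B \<otimes> y [^] (q ^ card B)}" for B
  have S: "finite (S B)" "card (S B) \<le> q ^ card B" "\<zero> \<in> S B" if "B \<in> orbits" for B
    using card_twisted_fixed[of "c B" "card B"] c(1)[OF that] card_pos[OF that] unfolding S_def by auto
  define \<Theta> where "\<Theta> x = (\<lambda>B\<in>orbits. dft (r B) x)" for x
  have orbit: "\<exists>c\<in>carrier L - {\<zero>}. \<exists>k. \<forall>x\<in>V n. dft j x = c \<otimes> (dft (r B) x) [^] (q ^ k)"
    if "B \<in> orbits" "j \<in> B" for j B
  proof -
    from that r(2) have "j \<in> mult_orbit q n (r B)" by blast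
    then obtain k where "j = r B * q ^ k mod n" by (auto simp: mult_orbit_def)
    then have "[r B * q ^ k = j] (mod n)" by (simp add: cong_def)
    then show ?thesis using dft_mult_q_pow[of "r B" k] dft_cong by metis
  qed
  have cover: "\<exists>B\<in>orbits. j \<in> B" if "j < n" for j using mult_orbit_self[OF n_pos cop that] that by blast
  have inj: "inj_on \<Theta> (V n)"
  proof (rule inj_onI)
    fix x y assume xy: "x \<in> V n" "y \<in> V n" and eq: "\<Theta> x = \<Theta> y"
    show "x = y"
    proof (rule dft_inj)
      fix j assume "j < n"
      then obtain B where B: "B \<in> orbits" "j \<in> B" using cover by blast
      have "dft (r B) x = dft (r B) y" using fun_cong[OF eq, of B] B by (simp add: \<Theta>_def)
      then show "dft j x = dft j y" using orbit[OF B] xy by metis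
    qed (use xy V_carrier in auto)
  qed
  have sub: "\<Theta> ` V n \<subseteq> PiE orbits S"
    using c(2) dft_closed V_carrier(2) unfolding \<Theta>_def S_def by (auto intro!: restrict_PiE_iff[THEN iffD2])
  have sum: "(\<Sum>B\<in>orbits. card B) = n"
  proof -
    have "(\<Sum>B\<in>orbits. card B) = card (\<Union>orbits)"
      using mult_orbit_partition[OF n_pos cop] mult_orbit_subset[OF n_pos cop]
      by (intro card_Union_disjoint[symmetric]) (auto simp: partition_on_def intro: finite_subset)
    also have "\<Union>orbits = {..<n}" using mult_orbit_partition[OF n_pos cop] by (simp add: partition_on_def)
    finally show ?thesis by simp
  qed
  have prodq: "(\<Prod>B\<in>orbits. q ^ card B) = q ^ n" using sum by (simp add: power_sum[symmetric])
  have finP: "finite (PiE orbits S)" using fin S by (intro finite_PiE) auto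
  have "q ^ n = card (\<Theta> ` V n)" using card_image[OF inj] card_V[OF n_pos] by simp
  also have "\<dots> \<le> card (PiE orbits S)" by (rule card_mono[OF finP sub])
  also have "\<dots> = (\<Prod>B\<in>orbits. card (S B))" by (rule card_PiE[OF fin])
  \<comment> \<open>This lower bound meets \<open>card (S B) \<le> q ^ card B\<close>, so every
    \<open>S B\<close> has full size and \<open>\<Theta>\<close> is onto.\<close>
  finally have ge: "q ^ n \<le> (\<Prod>B\<in>orbits. card (S B))" .
  have "(\<Prod>B\<in>orbits. card (S B)) \<le> (\<Prod>B\<in>orbits. q ^ card B)" by (rule prod_mono) (use S in auto)
  then have prodS: "(\<Prod>B\<in>orbits. card (S B)) = (\<Prod>B\<in>orbits. q ^ card B)" using ge prodq by simp
  have cardS: "card (S B) = q ^ card B" if "B \<in> orbits" for B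
    by (rule prod_eq_imp_eq[OF fin _ prodS _ that]) (use S prodq q_gt_1 in auto)
  have im: "\<Theta> ` V n = PiE orbits S"
    by (rule card_subset_eq[OF finP sub])
      (simp add: card_PiE fin prodS prodq card_image[OF inj] card_V[OF n_pos])
  have normal_iff: "normal n \<beta> \<longleftrightarrow> \<beta> \<in> V n \<and> (\<forall>B\<in>orbits. dft (r B) \<beta> \<noteq> \<zero>)" for \<beta>
  proof (intro iffI conjI ballI)
    assume nb: "normal n \<beta>"
    then show \<beta>: "\<beta> \<in> V n" by (simp add: normal_def)
    fix B assume B: "B \<in> orbits"
    show "dft (r B) \<beta> \<noteq> \<zero>"
    proof
      assume 0: "dft (r B) \<beta> = \<zero>"
      \<comment> \<open>The zero set of a coefficient is a submodule containing
        \<open>\<beta>\<close>, hence all of \<open>V n\<close>. But \<open>S B\<close> contains a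
        nonzero \<open>y\<close>, and surjectivity of \<open>\<Theta>\<close> produces an
        \<open>x\<close> having \<open>y\<close> as that coefficient.\<close>
      let ?U = "{x \<in> V n. dft (r B) x = \<zero>}"
      have "dft (r B) (x [^] q) = \<zero>" if "x \<in> ?U" for x
        using dft_frob_shift[of x "r B"] that z_pow_nonzero dft_closed[of "x [^] q" "r B"] V_carrier integral[of "z [^] r B"]
        by (metis (mono_tags, lifting) mem_Collect_eq nat_pow_closed z)
      then have "submodule n ?U"
        using dft_add dft_smult V_carrier V_mono[of 1 n] dft_smult[OF zero_closed V_closed(1)] dft_closed[OF zero_closed]
        unfolding submodule_def by (auto simp: subset_iff)
      then have U: "?U = V n" using nb 0 \<beta> unfolding normal_def by blast
      have "card (S B) > 1" using cardS[OF B] one_less_power[OF q_gt_1 card_pos[OF B]] by simp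
      then have "\<not> S B \<subseteq> {\<zero>}" using card_mono[of "{\<zero>}" "S B"] by auto
      then obtain y where y: "y \<in> S B" "y \<noteq> \<zero>" by auto
      define f where "f = (\<lambda>B'\<in>orbits. if B' = B then y else \<zero>)"
      have "f \<in> PiE orbits S" using y S by (auto simp: f_def)
      then obtain x where x: "x \<in> V n" "f = \<Theta> x" using im by blast
      have "f B = y" using B by (simp add: f_def)
      then have "dft (r B) x = y" using x B by (simp add: \<Theta>_def)
      then show False using U x y by auto
    qed
  next
    assume *: "\<beta> \<in> V n \<and> (\<forall>B\<in>orbits. dft (r B) \<beta> \<noteq> \<zero>)"
    then have \<beta>: "\<beta> \<in> V n" by simp
    \<comment> \<open>Nonvanishing at the representative spreads over its orbit, which makes the
      conjugates independent; a span of \<open>q ^ n\<close> elements inside \<open>V n\<close> is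
      then all of it.\<close>
    have "dft j \<beta> \<noteq> \<zero>" if "j < n" for j
    proof -
      from cover[OF that] obtain B where B: "B \<in> orbits" "j \<in> B" by blast
      from orbit[OF B] \<beta> obtain c k where "c \<in> carrier L - {\<zero>}" "dft j \<beta> = c \<otimes> (dft (r B) \<beta>) [^] (q ^ k)" by blast
      moreover have "dft (r B) \<beta> \<in> carrier L" using \<beta> V_carrier dft_closed by blast
      moreover have "dft (r B) \<beta> \<noteq> \<zero>" using * B by blast
      ultimately show ?thesis using nat_pow_nonzero[of "dft (r B) \<beta>" "q ^ k"] integral_iff by auto
    qed
    then have "independent (V 1) (conj n \<beta>)" by (rule independent_conj[OF \<beta>])
    moreover have "\<beta> \<in> carrier L" using \<beta> V_carrier by auto
    moreover have "card (V 1) = q" "finite (V 1)" using card_V[of 1] by auto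
    ultimately have "card (Span (V 1) (conj n \<beta>)) = q ^ n"
      using independent_iff_card_Span[OF subfield_V[of 1] _ conj_carrier[of \<beta> n]] by (simp add: conj_def)
    moreover have "Span (V 1) (conj n \<beta>) \<subseteq> V n" by (rule Span_conj_subset[OF submodule_V \<beta>])
    ultimately have "Span (V 1) (conj n \<beta>) = V n" using card_V[OF n_pos] by (intro card_subset_eq) auto
    then show "normal n \<beta>" unfolding normal_def using Span_conj_eq_iff[OF n_pos \<beta>] \<beta> by blast
  qed
  have "\<Theta> ` {\<beta>. normal n \<beta>} = PiE orbits (\<lambda>B. S B - {\<zero>})"
  proof (intro subset_antisym subsetI)
    fix f assume "f \<in> \<Theta> ` {\<beta>. normal n \<beta>}"
    then obtain x where x: "normal n x" "f = \<Theta> x" by blast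
    then have "f \<in> PiE orbits S" using sub normal_iff by blast
    then show "f \<in> PiE orbits (\<lambda>B. S B - {\<zero>})"
      using x normal_iff by (auto simp: PiE_iff \<Theta>_def)
  next
    fix f assume f: "f \<in> PiE orbits (\<lambda>B. S B - {\<zero>})"
    then have "f \<in> PiE orbits S" by (auto simp: PiE_iff)
    then obtain x where x: "x \<in> V n" "f = \<Theta> x" using im by blast
    have "dft (r B) x \<noteq> \<zero>" if "B \<in> orbits" for B
      using f that unfolding x(2) by (auto simp: PiE_iff \<Theta>_def)
    then show "f \<in> \<Theta> ` {\<beta>. normal n \<beta>}" using x normal_iff by blast
  qed
  then have "card (\<Theta> ` {\<beta>. normal n \<beta>}) = (\<Prod>B\<in>orbits. card (S B - {\<zero>}))"
    by (simp add: card_PiE[OF fin])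
  moreover have "inj_on \<Theta> {\<beta>. normal n \<beta>}"
    by (rule inj_on_subset[OF inj]) (auto simp: normal_def)
  ultimately have "card {\<beta>. normal n \<beta>} = (\<Prod>B\<in>orbits. card (S B - {\<zero>}))" by (simp add: card_image)
  also have "\<dots> = (\<Prod>B\<in>orbits. q ^ card B - 1)"
    by (rule prod.cong) (use S cardS in auto)
  finally show ?thesis .
qed

end

section \<open>The product formula for the density\<close>

definition normal_factor :: "nat \<Rightarrow> nat \<Rightarrow> real" where
  "normal_factor q e = (if coprime e q
     then (1 - 1 / real q ^ ord e q) powr (real (totient e) / real (ord e q)) else 1)"

context frobenius_tower
begin

text \<open>Strong induction: factors \<open>p\<close> are stripped by
  \<open>card_normal_step\<close> until \<open>n\<close> is coprime to \<open>q\<close>, where the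
  orbit count applies. Stripping does not change the product, because divisors of
  \<open>p * m\<close> that do not divide \<open>m\<close> are multiples of \<open>p\<close>, for
  which \<open>normal_factor\<close> has the value 1.\<close>

lemma normal_ratio:
  assumes "n > 0"
  shows "real (card {\<beta>. normal n \<beta>}) / real (q ^ n) = (\<Prod>e | e dvd n. normal_factor q e)"
  using assms
proof (induction n rule: less_induct)
  case (less n)
  show ?case
  proof (cases "coprime n q")
    case True
    obtain z where z: "z \<in> carrier L" "\<And>k::nat. z [^] k = \<one> \<longleftrightarrow> n dvd k"
      using exists_primitive_root[OF less.prems True] by blast
    interpret frobenius_tower_root L p a q n z
      by unfold_locales (use less.prems True z in auto)
    have "q ^ n = (\<Prod>B\<in>orbits. q ^ card B)"
    proof -
      have "n = card (\<Union>orbits)"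
        using mult_orbit_partition[OF n_pos cop] by (simp add: partition_on_def)
      also have "\<dots> = (\<Sum>B\<in>orbits. card B)"
        using mult_orbit_partition[OF n_pos cop] mult_orbit_subset[OF n_pos cop]
        by (intro card_Union_disjoint) (auto simp: partition_on_def intro: finite_subset)
      finally show ?thesis by (simp add: power_sum[symmetric])
    qed
    then have "real (card {\<beta>. normal n \<beta>}) / real (q ^ n)
        = (\<Prod>B\<in>orbits. real (q ^ card B - 1) / real (q ^ card B))"
      unfolding card_normal_coprime prod_dividef by simp
    also have "\<dots> = (\<Prod>B\<in>orbits. 1 - 1 / real q ^ card B)"
    proof (rule prod.cong[OF refl])
      fix B
      have "q ^ card B \<ge> 1" using q_gt_1 by simp
      then show "real (q ^ card B - 1) / real (q ^ card B) = 1 - 1 / real q ^ card B"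
        using q_gt_1 by (simp add: of_nat_diff diff_divide_distrib)
    qed
    also have "\<dots> = (\<Prod>e | e dvd n. (1 - 1 / real q ^ ord e q) powr (real (totient e) / real (ord e q)))"
    proof (rule prod_mult_orbits[OF n_pos cop])
      fix d :: nat assume "d > 0"
      then have "1 < real q ^ d" using one_less_power[of "real q" d] q_gt_1 by simp
      then have "1 / real q ^ d < 1" by (subst divide_less_eq_1) auto
      then show "1 - 1 / real q ^ d > 0" by simp
    qed
    also have "\<dots> = (\<Prod>e | e dvd n. normal_factor q e)"
    proof (rule prod.cong[OF refl])
      fix e assume "e \<in> {e. e dvd n}"
      then have "coprime e q" using coprime_divisors[of e n q q] cop by simp
      then show "(1 - 1 / real q ^ ord e q) powr (real (totient e) / real (ord e q)) = normal_factor q e"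
        by (simp add: normal_factor_def)
    qed
    finally show ?thesis .
  next
    case False
    then have "\<not> coprime n p" using a_pos by (simp add: q_eq)
    then have "p dvd n" using prime_p by (metis coprime_commute prime_imp_coprime)
    then obtain m where n: "n = p * m" by auto
    have m: "m > 0" "m < n" using less.prems prime_gt_1_nat[OF prime_p] by (auto simp: n)
    have "q ^ n = q ^ (n - m) * q ^ m" using m by (simp add: power_add[symmetric])
    then have "real (card {\<beta>. normal n \<beta>}) / real (q ^ n) = real (card {\<beta>. normal m \<beta>}) / real (q ^ m)"
      using card_normal_step[OF m(1)] q_gt_1 unfolding n by simp
    also have "\<dots> = (\<Prod>e | e dvd m. normal_factor q e)" using less.IH[OF m(2,1)] .
    also have "\<dots> = (\<Prod>e | e dvd n. normal_factor q e)"
    proof (rule prod.mono_neutral_left)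
      show "\<forall>e\<in>{e. e dvd n} - {e. e dvd m}. normal_factor q e = 1"
      proof
        fix e assume e: "e \<in> {e. e dvd n} - {e. e dvd m}"
        then have "\<not> coprime e p" using coprime_dvd_mult_right_iff[of e p m] by (auto simp: n)
        then have "\<not> coprime e q" using a_pos by (simp add: q_eq)
        then show "normal_factor q e = 1" by (simp add: normal_factor_def)
      qed
    qed (use less.prems n in auto)
    finally show ?thesis .
  qed
qed

text \<open>A spanning list of \<open>n\<close> conjugates is automatically independent by counting,
  so spanning alone decides. The span computed inside the subfield \<open>M\<close> is the one
  computed in \<open>L\<close>.\<close>

lemma normal_iff_basis:
  fixes \<beta> :: 'a
  assumes n: "n > 0"
  defines "M \<equiv> L\<lparr>carrier := V n\<rparr>"
  defines "cs \<equiv> map (\<lambda>i. \<beta> [^]\<^bsub>M\<^esub> (q ^ i)) [0..<n]"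
  shows "normal n \<beta> \<longleftrightarrow> \<beta> \<in> V n \<and>
    ring.independent M (V 1) cs \<and> ring.Span M (V 1) cs = V n"
proof (cases "\<beta> \<in> V n")
  case False
  then show ?thesis by (simp add: normal_def)
next
  case True
  have cs: "cs = conj n \<beta>"
    unfolding cs_def conj_def M_def nat_pow_def by simp
  interpret M: field M unfolding M_def by (rule subfield_iff(2)[OF subfield_V])
  have sf: "subfield (V 1) M"
  proof (rule M.subfield_iff(1))
    show "field (M\<lparr>carrier := V 1\<rparr>)" using subfield_iff(2)[OF subfield_V[of 1]] by (simp add: M_def)
    show "V 1 \<subseteq> carrier M" using V_mono[of 1 n] by (simp add: M_def)
  qed
  have csM: "set cs \<subseteq> carrier M" using True by (auto simp: cs conj_def M_def)
  have len: "length cs = n" by (simp add: cs conj_def)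
  have V1: "card (V 1) = q" "finite (V 1)" using card_V[of 1] by auto
  have SL: "M.Span (V 1) cs = Span (V 1) cs"
    unfolding M_def by (rule fun_cong[OF fun_cong[OF Span_consistent[OF subfieldE(1)[OF subfield_V]]]])
  have "M.independent (V 1) cs \<longleftrightarrow> card (M.Span (V 1) cs) = q ^ n"
    using M.independent_iff_card_Span[OF sf V1(2) csM] unfolding V1 len .
  then have "M.Span (V 1) cs = V n \<Longrightarrow> M.independent (V 1) cs" using card_V[OF n] by simp
  moreover have "normal n \<beta> \<longleftrightarrow> M.Span (V 1) cs = V n"
    unfolding normal_def SL unfolding cs Span_conj_eq_iff[OF n True] using True by (simp only: simp_thms)
  ultimately show ?thesis using True by metis
qed

end

text \<open>The abstract tower is instantiated with the algebraic closure of the integers modulo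
  \<open>p\<close>.\<close>

theorem normal_density_eq_prod:
  assumes q: "primepow q" and n: "n > 0"
  shows "normal_density q n = (\<Prod>e | e dvd n. normal_factor q e)"
proof -
  define p where "p = aprimedivisor q"
  define a where "a = multiplicity p q"
  have prime: "prime p" unfolding p_def using prime_aprimedivisor'[of q] primepow_gt_Suc_0[OF q] by simp
  have qa: "q = p ^ a" unfolding a_def p_def using primepow_decompose[OF q] by simp
  have a: "a > 0" using primepow_gt_Suc_0[OF q] qa by (cases a) auto
  define R where "R = residue_ring (int p)"
  interpret R: residues_prime p R
    by unfold_locales (use prime in \<open>simp_all add: R_def\<close>)
  define \<Omega> where "\<Omega> = R.alg_closure"
  interpret \<Omega>: algebraic_closure \<Omega> "R.indexed_const ` carrier R"
    unfolding \<Omega>_def by (rule R.alg_closureE(1))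
  have hom: "R.indexed_const \<in> ring_hom R \<Omega>" unfolding \<Omega>_def by (rule R.alg_closureE(2))
  interpret h: ring_hom_ring R \<Omega> R.indexed_const
    by (rule ring_hom_ringI2[OF R.ring_axioms \<Omega>.ring_axioms hom])
  have char: "[p] \<cdot>\<^bsub>\<Omega>\<^esub> \<one>\<^bsub>\<Omega>\<^esub> = \<zero>\<^bsub>\<Omega>\<^esub>"
  proof -
    have h: "R.indexed_const ([k] \<cdot>\<^bsub>R\<^esub> \<one>\<^bsub>R\<^esub>) = [k] \<cdot>\<^bsub>\<Omega>\<^esub> \<one>\<^bsub>\<Omega>\<^esub>" for k :: nat
      by (induction k) simp_all
    have "[k] \<cdot>\<^bsub>R\<^esub> \<one>\<^bsub>R\<^esub> = int k mod int p" for k :: nat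
      by (induction k) (simp_all add: R.res_zero_eq R.res_one_eq R.res_add_eq mod_add_right_eq mod_add_left_eq add.commute)
    then have "[p] \<cdot>\<^bsub>R\<^esub> \<one>\<^bsub>R\<^esub> = \<zero>\<^bsub>R\<^esub>" by (simp add: R.res_zero_eq)
    then show ?thesis using h[of p] by simp
  qed
  interpret T: frobenius_tower \<Omega> p a q
    by unfold_locales (use prime a qa char \<Omega>.card_frobenius_fixed[OF prime char] in auto)
  \<comment> \<open>\<open>aprimedivisor (q ^ k)\<close> is the same prime for all
    \<open>k > 0\<close>, so every \<open>GF (q ^ k)\<close> is cut out of the same closure.\<close>
  have GF: "GF (q ^ k) = \<Omega>\<lparr>carrier := T.V k\<rparr>" if "k > 0" for k
    unfolding GF_def aprimedivisor_primepow_power[OF q that] T.V_def Let_def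
      p_def[symmetric] R_def[symmetric] \<Omega>_def[symmetric] ..
  have GFq: "GF q = \<Omega>\<lparr>carrier := T.V 1\<rparr>" using GF[of 1] by simp
  have "is_normal q n \<beta> \<longleftrightarrow> T.normal n \<beta>" for \<beta>
    unfolding is_normal_def Let_def GF[OF n] GFq T.normal_iff_basis[OF n] by simp
  then have "is_normal q n = T.normal n" ..
  then show ?thesis unfolding normal_density_def by (simp only: T.normal_ratio[OF n])
qed

subsection \<open>Means of products over divisors\<close>

text \<open>Grouping by the value of the gcd. Read from right to left, it turns the totient-weighted
  sum of \<open>A_seq\<close> into a sum over one period.\<close>

lemma sum_gcd_eq_sum_divisors:
  fixes g :: "nat \<Rightarrow> real"
  assumes "n > 0"
  shows "(\<Sum>m=1..n. g (gcd m n)) = (\<Sum>r | r dvd n. g r * real (totient (n div r)))"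
proof -
  have "(\<Sum>m=1..n. g (gcd m n)) = (\<Sum>r | r dvd n. \<Sum>m\<in>{m\<in>{1..n}. gcd m n = r}. g (gcd m n))"
    using assms by (intro sum.group[symmetric]) auto
  also have "\<dots> = (\<Sum>r | r dvd n. g r * real (totient (n div r)))"
  proof (rule sum.cong[OF refl])
    fix r assume "r \<in> {r. r dvd n}"
    moreover have "{1..n} = {0<..n}" by auto
    ultimately have "card {m\<in>{1..n}. gcd m n = r} = totient (n div r)"
      using card_gcd_eq_totient[OF assms, of r] by simp
    then show "(\<Sum>m\<in>{m\<in>{1..n}. gcd m n = r}. g (gcd m n)) = g r * real (totient (n div r))"
      by simp
  qed
  finally show ?thesis .
qed

lemma sum_periodic:
  fixes h :: "nat \<Rightarrow> real"
  assumes "\<And>n. h (n + L) = h n"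
  shows "(\<Sum>m=1..k*L. h m) = real k * (\<Sum>m=1..L. h m)"
proof (induction k)
  case (Suc k)
  have *: "h (m + k * L) = h m" for m
  proof (induction k)
    case (Suc k)
    then show ?case using assms[of "m + k * L"] by (simp add: algebra_simps)
  qed simp
  have "(\<Sum>m=1..k*L+L. h m) = (\<Sum>m=1..k*L. h m) + (\<Sum>m=k*L+1..k*L+L. h m)"
    by (rule sum.ub_add_nat) simp
  also have "(\<Sum>m=k*L+1..k*L+L. h m) = (\<Sum>m=1..L. h (m + k * L))"
    using sum.shift_bounds_cl_nat_ivl[of h 1 "k*L" L] by (simp add: add.commute)
  also have "(\<Sum>m=1..L. h (m + k * L)) = (\<Sum>m=1..L. h m)" by (simp only: *)
  finally have "(\<Sum>m=1..k*L+L. h m) = real k * (\<Sum>m=1..L. h m) + (\<Sum>m=1..L. h m)"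
    unfolding Suc .
  then show ?case by (simp add: algebra_simps)
qed simp

text \<open>Complete periods contribute exactly their mean; the incomplete one, of length
  \<open>r < L\<close>, costs at most \<open>L\<close>.\<close>

lemma sum_periodic_mean:
  fixes h :: "nat \<Rightarrow> real"
  assumes per: "\<And>n. h (n + L) = h n" and L: "L > 0" and h: "\<And>n. 0 \<le> h n" "\<And>n. h n \<le> 1"
  shows "\<bar>(\<Sum>m=1..N. h m) - real N * ((\<Sum>m=1..L. h m) / real L)\<bar> \<le> real L"
proof -
  define k r where "k = N div L" and "r = N mod L"
  have N: "N = k * L + r" by (simp add: k_def r_def)
  have r: "r < L" using L by (simp add: r_def)
  define A where "A = (\<Sum>m=1..L. h m) / real L"
  have "(\<Sum>m=1..L. h m) \<ge> 0" by (intro sum_nonneg h)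
  then have A0: "A \<ge> 0" by (simp add: A_def)
  have "(\<Sum>m=1..L. h m) \<le> real L" using sum_bounded_above[of "{1..L}" h 1] h by simp
  then have A1: "A \<le> 1" using L by (simp add: A_def)
  have LA: "(\<Sum>m=1..L. h m) = L * A" using L by (simp add: A_def)
  have s: "(\<Sum>m=1..N. h m) = real k * (L * A) + (\<Sum>m=k*L+1..k*L+r. h m)"
    unfolding N LA[symmetric] sum_periodic[of h L k, OF per, symmetric] by (rule sum.ub_add_nat) simp
  have "(\<Sum>m=k*L+1..k*L+r. h m) \<ge> 0" by (intro sum_nonneg h)
  moreover have "(\<Sum>m=k*L+1..k*L+r. h m) \<le> real r"
    using sum_bounded_above[of "{k*L+1..k*L+r}" h 1] h by simp
  moreover have "real r * A \<ge> 0" "real r * A \<le> real r" using A0 A1 by (simp_all add: mult_left_le)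
  moreover have "real N * A = real k * (L * A) + real r * A" by (simp add: N algebra_simps)
  ultimately show ?thesis unfolding A_def[symmetric] s using r by linarith
qed

lemma card_multiples:
  assumes "e > 0"
  shows "card {m\<in>{1..N::nat}. e dvd m} = N div e"
proof -
  have "{m\<in>{1..N::nat}. e dvd m} = (\<lambda>k. e * k) ` {1..N div e}"
  proof (intro subset_antisym subsetI)
    fix m assume "m \<in> {m\<in>{1..N::nat}. e dvd m}"
    then obtain k where "m = e * k" "1 \<le> m" "m \<le> N" by auto
    then show "m \<in> (\<lambda>k. e * k) ` {1..N div e}"
      using assms by (auto simp: less_eq_div_iff_mult_less_eq mult.commute intro!: imageI)
  next
    fix m assume "m \<in> (\<lambda>k. e * k) ` {1..N div e}"
    then show "m \<in> {m\<in>{1..N::nat}. e dvd m}"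
      using assms by (auto simp: less_eq_div_iff_mult_less_eq mult.commute)
  qed
  then show ?thesis using assms by (simp add: card_image inj_on_def)
qed

lemma one_minus_prod_le_sum:
  fixes f :: "'a \<Rightarrow> real"
  assumes "finite S" "\<And>x. x \<in> S \<Longrightarrow> 0 \<le> f x \<and> f x \<le> 1"
  shows "1 - prod f S \<le> (\<Sum>x\<in>S. 1 - f x)"
  using assms
proof (induction S rule: finite_induct)
  case (insert x S)
  have "prod f S \<le> 1" "0 \<le> prod f S" using insert.prems by (auto intro: prod_le_1 prod_nonneg)
  then have "f x * (1 - prod f S) \<le> 1 * (1 - prod f S)"
    using insert.prems by (intro mult_right_mono) auto
  then have "1 - f x * prod f S \<le> (1 - f x) + (1 - prod f S)" by (simp add: algebra_simps)
  then show ?case using insert by simp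
qed simp

text \<open>Of two complementary divisors at least one is at most the square root.\<close>

lemma card_divisors_le_sqrt:
  assumes "n > 0"
  shows "real (card {d. d dvd n}) \<le> 2 * sqrt (real n)"
proof -
  define k where "k = floor_sqrt n"
  have k2: "k * k \<le> n" "n < (k + 1) * (k + 1)"
    using floor_sqrt_power2_le[of n] Suc_floor_sqrt_power2_gt[of n] by (auto simp: k_def power2_eq_square)
  have "{d. d dvd n} \<subseteq> {1..k} \<union> (\<lambda>d. n div d) ` {1..k}"
  proof
    fix d assume "d \<in> {d. d dvd n}"
    then obtain c where n: "n = d * c" by auto
    have pos: "d > 0" "c > 0" using assms n by auto
    have "d \<le> k \<or> c \<le> k"
    proof (rule ccontr)
      assume "\<not> (d \<le> k \<or> c \<le> k)"
      then have "(k + 1) * (k + 1) \<le> d * c" by (intro mult_le_mono) auto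
      then show False using k2 n by simp
    qed
    moreover have "n div c = d" using pos by (simp add: n)
    ultimately show "d \<in> {1..k} \<union> (\<lambda>d. n div d) ` {1..k}" using pos by (auto intro!: rev_image_eqI[of c])
  qed
  then have "card {d. d dvd n} \<le> card ({1..k} \<union> (\<lambda>d. n div d) ` {1..k})"
    by (intro card_mono) auto
  also have "\<dots> \<le> card {1..k} + card ((\<lambda>d. n div d) ` {1..k})" by (rule card_Un_le)
  also have "\<dots> \<le> 2 * k" using card_image_le[of "{1..k}" "\<lambda>d. n div d"] by simp
  finally have "real (card {d. d dvd n}) \<le> 2 * real k" by linarith
  moreover have "real k \<le> sqrt (real n)"
  proof (rule real_le_rsqrt)
    have "real (k * k) \<le> real n" using k2(1) of_nat_le_iff by blast
    then show "(real k)\<^sup>2 \<le> real n" by (simp add: power2_eq_square)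
  qed
  ultimately show ?thesis by linarith
qed


text \<open>The \<open>L t\<close> form a chain of periods that absorbs every
  \<open>e \<le> t\<close> whose factor differs from 1. Summability is stated with
  \<open>- ln (f e)\<close>, which dominates \<open>1 - f e\<close> and is also what the exponential
  lower bound calls for. The term at \<open>e = 0\<close> is 0, as division by zero gives 0.\<close>

locale divisor_product_mean =
  fixes f :: "nat \<Rightarrow> real" and L :: "nat \<Rightarrow> nat"
  assumes f_pos: "0 < f e" and f_le_1: "f e \<le> 1"
    and summable: "summable (\<lambda>e. - ln (f e) / real e)"
    and L_pos: "L t > 0" and L_dvd: "L t dvd L (Suc t)"
    and dvd_L: "e > 0 \<Longrightarrow> e \<le> t \<Longrightarrow> f e \<noteq> 1 \<Longrightarrow> e dvd L t"
begin

definition g :: "nat \<Rightarrow> real" where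
  "g n = (\<Prod>e | e dvd n. f e)"

definition A :: "nat \<Rightarrow> real" where
  "A t = (\<Sum>m=1..L t. g (gcd m (L t))) / real (L t)"

lemma g_pos: "0 < g n" and g_le_1: "g n \<le> 1"
  unfolding g_def by (auto intro: prod_pos prod_le_1 simp: f_pos f_le_1 less_imp_le)

text \<open>The multiple has more divisors, and each factor is at most 1. The condition
  \<open>n > 0\<close> keeps the set of divisors finite; over the infinite set of divisors of 0 the
  product is 1 by default.\<close>

lemma g_antimono:
  assumes "m dvd n" "n > 0"
  shows "g n \<le> g m"
proof -
  have "g n = prod f ({e. e dvd n} - {e. e dvd m}) * g m"
    unfolding g_def by (rule prod.subset_diff) (use assms in \<open>auto intro: dvd_trans\<close>)
  also have "\<dots> \<le> 1 * g m"
    using prod_le_1[of _ f] f_pos f_le_1 g_pos by (intro mult_right_mono) (auto simp: less_imp_le)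
  finally show ?thesis by simp
qed

text \<open>Only the divisors of \<open>m\<close> that do not divide \<open>K\<close> distinguish
  the two products, and 1 minus the product of their factors is at most the sum of the deficits
  \<open>1 - f e\<close>.\<close>

lemma g_gcd_diff:
  assumes "m > 0"
  shows "g (gcd m K) - g m \<le> (\<Sum>e | e dvd m \<and> \<not> e dvd K. 1 - f e)"
proof -
  let ?R = "{e. e dvd m \<and> \<not> e dvd K}"
  have fin: "finite {e. e dvd m}" using assms by simp
  have "g m = prod f ({e. e dvd m} - {e. e dvd gcd m K}) * g (gcd m K)"
    unfolding g_def by (rule prod.subset_diff) (use fin in auto)
  also have "{e. e dvd m} - {e. e dvd gcd m K} = ?R" by auto
  finally have "g m = g (gcd m K) * prod f ?R" by simp
  then have "g (gcd m K) - g m = g (gcd m K) * (1 - prod f ?R)" by (simp add: algebra_simps)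
  also have "\<dots> \<le> 1 * (1 - prod f ?R)"
  proof (intro mult_right_mono g_le_1)
    show "0 \<le> 1 - prod f ?R"
      using prod_le_1[of ?R f] f_pos f_le_1 by (simp add: less_imp_le)
  qed
  also have "1 * (1 - prod f ?R) \<le> (\<Sum>e\<in>?R. 1 - f e)"
    using one_minus_prod_le_sum[of ?R f] finite_subset[OF _ fin, of ?R] f_pos f_le_1 by (auto simp: less_imp_le)
  finally show ?thesis .
qed

definition tail :: "nat \<Rightarrow> real" where
  "tail t = (\<Sum>e. - ln (f e) / real e) - (\<Sum>e\<le>t. - ln (f e) / real e)"

lemma neg_ln_nonneg: "- ln (f e) / real e \<ge> 0"
  using f_pos[of e] f_le_1[of e] by (simp add: divide_nonpos_nonneg)

lemma tail_tendsto_0: "tail \<longlonglongrightarrow> 0"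
proof -
  have "(\<lambda>t. (\<Sum>e. - ln (f e) / real e) - (\<Sum>e\<le>t. - ln (f e) / real e)) \<longlonglongrightarrow>
      (\<Sum>e. - ln (f e) / real e) - (\<Sum>e. - ln (f e) / real e)"
    by (intro tendsto_intros summable_LIMSEQ'[OF summable])
  then show ?thesis by (simp add: tail_def[abs_def])
qed

text \<open>Each \<open>e\<close> not dividing \<open>L t\<close> is charged once for each of its at
  most \<open>N / e\<close> multiples up to \<open>N\<close>; those with
  \<open>f e \<noteq> 1\<close> exceed \<open>t\<close>. The resulting bound on the mean is uniform
  in \<open>N\<close>.\<close>

lemma sum_g_diff: "(\<Sum>m=1..N. g (gcd m (L t))) - (\<Sum>m=1..N. g m) \<le> real N * tail t"
proof -
  have "(\<Sum>m=1..N. g (gcd m (L t))) - (\<Sum>m=1..N. g m)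
      = (\<Sum>m=1..N. g (gcd m (L t)) - g m)" by (simp add: sum_subtractf)
  also have "\<dots> \<le> (\<Sum>m=1..N. \<Sum>e | e \<in> {1..N} \<and> \<not> e dvd L t \<and> e dvd m. 1 - f e)"
  proof (rule sum_mono)
    fix m assume m: "m \<in> {1..N}"
    have "e \<in> {1..N}" if "e dvd m" for e
      using dvd_imp_le[OF that] dvd_pos_nat[OF _ that] m by simp
    then have "{e. e dvd m \<and> \<not> e dvd L t} = {e. e \<in> {1..N} \<and> \<not> e dvd L t \<and> e dvd m}" by blast
    then show "g (gcd m (L t)) - g m \<le> (\<Sum>e | e \<in> {1..N} \<and> \<not> e dvd L t \<and> e dvd m. 1 - f e)"
      using g_gcd_diff[of m "L t"] m by simp
  qed
  also have "\<dots> = (\<Sum>m=1..N. \<Sum>e | e \<in> {e\<in>{1..N}. \<not> e dvd L t} \<and> e dvd m. 1 - f e)"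
    by (simp only: mem_Collect_eq conj_assoc)
  also have "\<dots> = (\<Sum>e\<in>{e\<in>{1..N}. \<not> e dvd L t}. \<Sum>m | m \<in> {1..N} \<and> e dvd m. 1 - f e)"
    by (rule sum.swap_restrict) auto
  also have "\<dots> = (\<Sum>e\<in>{e\<in>{1..N}. \<not> e dvd L t}. real (N div e) * (1 - f e))"
    by (intro sum.cong refl) (use card_multiples[of _ N] in auto)
  also have "\<dots> \<le> (\<Sum>e\<in>{e\<in>{1..N}. \<not> e dvd L t}. real N * (- ln (f e) / real e))"
  proof (rule sum_mono)
    fix e assume e: "e \<in> {e\<in>{1..N}. \<not> e dvd L t}"
    have "real (N div e) \<le> real N / real e" by (rule of_nat_div_le_of_nat)
    moreover have "1 - f e \<le> - ln (f e)" using ln_le_minus_one[OF f_pos[of e]] by simp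
    ultimately have "real (N div e) * (1 - f e) \<le> (real N / real e) * (- ln (f e))"
      using f_le_1[of e] by (intro mult_mono) auto
    then show "real (N div e) * (1 - f e) \<le> real N * (- ln (f e) / real e)" by simp
  qed
  also have "\<dots> = real N * (\<Sum>e\<in>{e\<in>{1..N}. \<not> e dvd L t}. - ln (f e) / real e)"
    by (simp only: sum_distrib_left)
  also have "(\<Sum>e\<in>{e\<in>{1..N}. \<not> e dvd L t}. - ln (f e) / real e) \<le> tail t"
  proof -
    \<comment> \<open>The upper end \<open>max t N\<close> keeps the split at \<open>t\<close> valid
      when \<open>N < t\<close>.\<close>
    have "(\<Sum>e\<in>{e\<in>{1..N}. \<not> e dvd L t}. - ln (f e) / real e) \<le> (\<Sum>e\<in>{t<..max t N}. - ln (f e) / real e)"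
    proof -
      have "(\<Sum>e\<in>{e\<in>{1..N}. \<not> e dvd L t}. - ln (f e) / real e)
          = (\<Sum>e\<in>{e\<in>{1..N}. \<not> e dvd L t \<and> f e \<noteq> 1}. - ln (f e) / real e)"
        by (rule sum.mono_neutral_right) auto
      also have "\<dots> \<le> (\<Sum>e\<in>{t<..max t N}. - ln (f e) / real e)"
      proof (rule sum_mono2)
        show "{e\<in>{1..N}. \<not> e dvd L t \<and> f e \<noteq> 1} \<subseteq> {t<..max t N}"
        proof
          fix e assume e: "e \<in> {e\<in>{1..N}. \<not> e dvd L t \<and> f e \<noteq> 1}"
          then have "t < e" using dvd_L[of e t] by (cases "t < e") auto
          then show "e \<in> {t<..max t N}" using e by simp
        qed
      qed (use neg_ln_nonneg in auto)
      finally show ?thesis .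
    qed
    also have "\<dots> = (\<Sum>e\<le>max t N. - ln (f e) / real e) - (\<Sum>e\<le>t. - ln (f e) / real e)"
      using sum.union_disjoint[of "{..t}" "{t<..max t N}" "\<lambda>e. - ln (f e) / real e"]
        ivl_disj_un_one(3)[of t "max t N"] by (simp add: ivl_disj_int)
    also have "(\<Sum>e\<le>max t N. - ln (f e) / real e) \<le> (\<Sum>e. - ln (f e) / real e)"
      by (rule sum_le_suminf[OF summable]) (use neg_ln_nonneg in auto)
    finally show ?thesis by (simp add: tail_def)
  qed
  finally show ?thesis by (simp add: mult_left_mono)
qed

lemma sum_g_gcd: "\<bar>(\<Sum>m=1..N. g (gcd m (L t))) - real N * A t\<bar> \<le> real (L t)"
  unfolding A_def by (rule sum_periodic_mean) (use L_pos g_pos g_le_1 in \<open>auto simp: less_imp_le\<close>)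

text \<open>Both means are taken over the common period \<open>L (Suc t)\<close>, where the gcd with
  \<open>L (Suc t)\<close> is a multiple of the gcd with \<open>L t\<close>.\<close>

lemma A_Suc_le: "A (Suc t) \<le> A t"
proof -
  obtain k where k: "L (Suc t) = k * L t" using L_dvd[of t] by (metis dvd_div_mult_self)
  have "k > 0" using L_pos[of "Suc t"] k by (cases k) auto
  have "(\<Sum>m=1..L (Suc t). g (gcd m (L (Suc t)))) \<le> (\<Sum>m=1..L (Suc t). g (gcd m (L t)))"
    by (intro sum_mono g_antimono gcd_mono) (use L_dvd[of t] L_pos in auto)
  also have "\<dots> = real k * (\<Sum>m=1..L t. g (gcd m (L t)))"
    unfolding k by (rule sum_periodic) simp
  finally have "A (Suc t) \<le> real k * (\<Sum>m=1..L t. g (gcd m (L t))) / real (L (Suc t))"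
    unfolding A_def by (intro divide_right_mono) auto
  also have "\<dots> = A t" using \<open>k > 0\<close> L_pos[of t] by (simp add: k A_def)
  finally show ?thesis .
qed

text \<open>Jensen's inequality for the exponential, through its tangent at \<open>- W\<close>.\<close>

lemma A_ge: "exp (- (\<Sum>e. - ln (f e) / real e)) \<le> A t"
proof -
  define W where "W = (\<Sum>e. - ln (f e) / real e)"
  define K where "K = L t"
  have K: "K > 0" by (simp add: K_def L_pos)
  let ?D = "{e. e dvd K}"
  have fin: "finite ?D" using K by simp
  define y where "y m = (\<Sum>e | e \<in> ?D \<and> e dvd m. - ln (f e))" for m
  have g: "g (gcd m K) = exp (- y m)" for m
  proof -
    have "exp (- y m) = exp (\<Sum>e | e \<in> ?D \<and> e dvd m. ln (f e))" by (simp add: y_def sum_negf)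
    also have "\<dots> = (\<Prod>e | e \<in> ?D \<and> e dvd m. f e)" using fin by (subst exp_sum) (auto simp: f_pos)
    also have "{e. e \<in> ?D \<and> e dvd m} = {e. e dvd gcd m K}" by auto
    finally show ?thesis by (simp add: g_def)
  qed
  \<comment> \<open>Each divisor \<open>e\<close> of \<open>K\<close> divides exactly
    \<open>K / e\<close> of the numbers from 1 to \<open>K\<close>, so the mean of \<open>y\<close>
    is a finite subsum of the series and is at most \<open>W\<close>.\<close>
  have "(\<Sum>m=1..K. y m) = (\<Sum>e\<in>?D. \<Sum>m | m \<in> {1..K} \<and> e dvd m. - ln (f e))"
    unfolding y_def by (rule sum.swap_restrict) (use fin in auto)
  also have "\<dots> = (\<Sum>e\<in>?D. real K * (- ln (f e) / real e))"
  proof (rule sum.cong[OF refl])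
    fix e assume "e \<in> ?D"
    then have "card {m\<in>{1..K}. e dvd m} = K div e" "real (K div e) = real K / real e"
      using card_multiples[of e K] K dvd_pos_nat[of K e] by (simp_all add: real_of_nat_div)
    then show "(\<Sum>m | m \<in> {1..K} \<and> e dvd m. - ln (f e)) = real K * (- ln (f e) / real e)"
      by simp
  qed
  also have "\<dots> = real K * (\<Sum>e\<in>?D. - ln (f e) / real e)" by (simp only: sum_distrib_left)
  also have "\<dots> \<le> real K * W"
    unfolding W_def by (intro mult_left_mono sum_le_suminf[OF summable]) (use fin neg_ln_nonneg in auto)
  finally have y: "(\<Sum>m=1..K. y m) \<le> real K * W" .
  \<comment> \<open>The tangent values summed over a period: the constant terms give
    \<open>K * exp (- W)\<close>, and the linear terms add up to something nonnegative by the bound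
    on the mean of \<open>y\<close>.\<close>
  have "real K * exp (- W) \<le> exp (- W) * (real K * (1 + W) - (\<Sum>m=1..K. y m))"
    using y by (simp add: algebra_simps)
  also have "\<dots> = (\<Sum>m=1..K. exp (- W) * (1 + (W - y m)))"
    by (simp add: sum_distrib_left[symmetric] sum.distrib sum_subtractf) (simp add: algebra_simps)
  also have "\<dots> \<le> (\<Sum>m=1..K. g (gcd m K))"
  proof (rule sum_mono)
    fix m
    have "exp (- W) * (1 + (W - y m)) \<le> exp (- W) * exp (W - y m)"
      by (intro mult_left_mono exp_ge_add_one_self) auto
    then show "exp (- W) * (1 + (W - y m)) \<le> g (gcd m K)" by (simp add: g mult_exp_exp)
  qed
  finally show ?thesis using K unfolding A_def K_def[symmetric] W_def[symmetric]
    by (simp add: pos_le_divide_eq mult.commute)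
qed

lemma A_le_1: "A t \<le> 1"
proof -
  have "(\<Sum>m=1..L t. g (gcd m (L t))) \<le> real (L t)"
    using sum_bounded_above[of "{1..L t}" "\<lambda>m. g (gcd m (L t))" 1] g_le_1 by simp
  then show ?thesis using L_pos[of t] by (simp add: A_def)
qed

definition mean :: real where "mean = lim A"

lemma A_tendsto: "A \<longlonglongrightarrow> mean"
proof -
  have "decseq A" using A_Suc_le by (rule decseq_SucI)
  then have "convergent A"
    using A_ge by (intro Bseq_monoseq_convergent decseq_bounded) (auto simp: decseq_imp_monoseq)
  then show ?thesis by (simp add: mean_def convergent_LIMSEQ_iff)
qed

lemma mean_ge: "exp (- (\<Sum>e. - ln (f e) / real e)) \<le> mean"
  by (rule LIMSEQ_le_const[OF A_tendsto]) (use A_ge in auto)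

lemma mean_le_1: "mean \<le> 1"
  by (rule LIMSEQ_le_const2[OF A_tendsto]) (use A_le_1 in auto)

text \<open>Three errors of a third each. First \<open>t\<close> is fixed so that \<open>A t\<close>
  is close to its limit and the tail is small, then \<open>N\<close> is taken large compared to the
  period \<open>L t\<close>.\<close>

lemma average_tendsto: "(\<lambda>N. (\<Sum>m=1..N. g m) / real N) \<longlonglongrightarrow> mean"
proof (rule LIMSEQ_I)
  fix r :: real assume r: "r > 0"
  have "\<forall>\<^sub>F t in sequentially. dist (A t) mean < r / 3"
    by (rule tendstoD[OF A_tendsto]) (use r in simp)
  moreover have "\<forall>\<^sub>F t in sequentially. dist (tail t) 0 < r / 3"
    by (rule tendstoD[OF tail_tendsto_0]) (use r in simp)
  ultimately have "\<forall>\<^sub>F t in sequentially. dist (A t) mean < r / 3 \<and> dist (tail t) 0 < r / 3"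
    by (rule eventually_conj)
  then obtain t where t: "\<bar>A t - mean\<bar> < r / 3" "tail t < r / 3"
    by (auto simp: eventually_sequentially dist_real_def)
  \<comment> \<open>This threshold makes the error \<open>L t\<close> of an incomplete period less
    than \<open>N * (r / 3)\<close>.\<close>
  obtain N0 :: nat where N0: "real (L t) / (r / 3) < real N0" using reals_Archimedean2 by blast
  show "\<exists>N0. \<forall>N\<ge>N0. norm ((\<Sum>m=1..N. g m) / real N - mean) < r"
  proof (intro exI allI impI)
    fix N assume N: "N0 \<le> N"
    have LN: "real (L t) / (r / 3) < real N" using N0 N by linarith
    have "0 \<le> real (L t) / (r / 3)" using r by simp
    then have Np: "real N > 0" using LN by linarith
    have LN': "real (L t) < real N * (r / 3)" using LN r by (simp add: pos_divide_less_eq)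
    define S where "S = (\<Sum>m=1..N. g m)"
    have up: "S \<le> (\<Sum>m=1..N. g (gcd m (L t)))"
      unfolding S_def by (intro sum_mono g_antimono) auto
    have "\<bar>(\<Sum>m=1..N. g (gcd m (L t))) - real N * A t\<bar> < real N * (r / 3)"
      using sum_g_gcd[of t N] LN' by linarith
    moreover have "(\<Sum>m=1..N. g (gcd m (L t))) - S \<le> real N * (r / 3)"
      using sum_g_diff[of t N] mult_left_mono[of "tail t" "r / 3" "real N"] t(2) by (simp add: S_def)
    moreover have "\<bar>real N * A t - real N * mean\<bar> \<le> real N * (r / 3)"
      using t(1) Np by (simp flip: right_diff_distrib add: abs_mult)
    ultimately have "\<bar>S - real N * mean\<bar> < real N * (r / 3) + real N * (r / 3) + real N * (r / 3)"
      using up by linarith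
    then have *: "\<bar>S - real N * mean\<bar> < real N * r" by (simp add: mult.commute)
    have "S / real N - mean = (S - real N * mean) / real N" using Np by (simp add: field_simps)
    then show "norm ((\<Sum>m=1..N. g m) / real N - mean) < r"
      using * Np unfolding S_def[symmetric] by (simp add: pos_divide_less_eq mult.commute)
  qed
qed

text \<open>The sum stops at the integer part of \<open>x\<close>, and the ratio of the integer part
  to \<open>x\<close> tends to 1.\<close>

lemma real_average_tendsto:
  "((\<lambda>x::real. (1 / x) * (\<Sum>n | 1 \<le> n \<and> real n \<le> x. g n)) \<longlongrightarrow> mean) at_top"
proof -
  have lim: "((\<lambda>x::real. (\<Sum>m=1..nat \<lfloor>x\<rfloor>. g m) / real (nat \<lfloor>x\<rfloor>)) \<longlongrightarrow> mean) at_top"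
    by (rule filterlim_compose[OF average_tendsto])
      (rule filterlim_compose[OF filterlim_nat_sequentially filterlim_floor_sequentially])
  moreover have "((\<lambda>x::real. real (nat \<lfloor>x\<rfloor>) / x) \<longlongrightarrow> 1) at_top"
  proof (rule tendsto_sandwich)
    have "((\<lambda>x::real. 1 - inverse x) \<longlongrightarrow> 1 - 0) at_top"
      by (intro tendsto_diff tendsto_const tendsto_inverse_0_at_top filterlim_ident)
    then show "((\<lambda>x::real. 1 - inverse x) \<longlongrightarrow> 1) at_top" by simp
    show "\<forall>\<^sub>F x::real in at_top. 1 - inverse x \<le> real (nat \<lfloor>x\<rfloor>) / x"
      using eventually_gt_at_top[of 0]
    proof eventually_elim
      case (elim x)
      have "x - 1 \<le> real (nat \<lfloor>x\<rfloor>)" by linarith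
      then have "(x - 1) / x \<le> real (nat \<lfloor>x\<rfloor>) / x" using elim by (simp add: divide_right_mono)
      then show ?case using elim by (simp add: diff_divide_distrib inverse_eq_divide)
    qed
    show "\<forall>\<^sub>F x::real in at_top. real (nat \<lfloor>x\<rfloor>) / x \<le> 1"
      using eventually_gt_at_top[of 0] by eventually_elim (simp add: divide_le_eq)
  qed simp
  ultimately have "((\<lambda>x::real. (\<Sum>m=1..nat \<lfloor>x\<rfloor>. g m) / real (nat \<lfloor>x\<rfloor>) * (real (nat \<lfloor>x\<rfloor>) / x)) \<longlongrightarrow> mean * 1) at_top"
    by (rule tendsto_mult)
  moreover have "\<forall>\<^sub>F x::real in at_top. (\<Sum>m=1..nat \<lfloor>x\<rfloor>. g m) / real (nat \<lfloor>x\<rfloor>) * (real (nat \<lfloor>x\<rfloor>) / x)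
      = (1 / x) * (\<Sum>n | 1 \<le> n \<and> real n \<le> x. g n)"
    using eventually_ge_at_top[of 1]
  proof eventually_elim
    case (elim x)
    have "{n. 1 \<le> n \<and> real n \<le> x} = {1..nat \<lfloor>x\<rfloor>}"
      using elim by (auto simp: le_nat_iff le_floor_iff)
    moreover have "nat \<lfloor>x\<rfloor> > 0" using elim by simp
    ultimately show ?case by simp
  qed
  ultimately have "((\<lambda>x::real. (1 / x) * (\<Sum>n | 1 \<le> n \<and> real n \<le> x. g n)) \<longlongrightarrow> mean * 1) at_top"
    by (rule Lim_transform_eventually)
  then show ?thesis by (simp only: mult_1_right)
qed

end


subsection \<open>Estimates for the local factors\<close>

text \<open>The order divides \<open>totient e\<close>, which bounds it by \<open>e\<close>. That
  bound puts \<open>q ^ ord e q - 1\<close> among the numbers whose least common multiple is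
  \<open>L_seq q t\<close> as soon as \<open>t \<ge> e\<close>.\<close>

lemma ord_properties:
  fixes e q :: nat
  assumes "coprime e q" "e > 0"
  shows "ord e q > 0" "ord e q \<le> e" "e dvd q ^ ord e q - 1"
proof -
  show *: "ord e q > 0" using assms ord_eq_0[of e q] by (cases "ord e q = 0") auto
  have "ord e q dvd totient e" by (rule order_divides_totient[OF assms(1)])
  then have "ord e q \<le> totient e" by (rule dvd_imp_le) (use assms in simp)
  then show "ord e q \<le> e" using totient_le[of e] by linarith
  have "[q ^ ord e q = 1] (mod e)" by (rule iffD2[OF ord_divides dvd_refl])
  then show "e dvd q ^ ord e q - 1" by (rule cong_to_1_nat)
qed

lemma normal_factor_pos: "q > 1 \<Longrightarrow> 0 < normal_factor q e"
  and normal_factor_le_1: "q > 1 \<Longrightarrow> normal_factor q e \<le> 1"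
  and neg_ln_normal_factor_nonneg: "q > 1 \<Longrightarrow> - ln (normal_factor q e) / real e \<ge> 0"
proof -
  assume q: "q > 1"
  have "normal_factor q e > 0 \<and> normal_factor q e \<le> 1"
  proof (cases "coprime e q")
    case True
    have "e > 0" using True q by (cases e) auto
    then have "ord e q > 0" using ord_properties(1)[OF True] by simp
    then have "1 < real q ^ ord e q" using q by (intro one_less_power) auto
    then have "0 < 1 - 1 / real q ^ ord e q" "1 - 1 / real q ^ ord e q \<le> 1" by (simp_all add: divide_less_eq)
    then show ?thesis using True unfolding normal_factor_def by (auto intro!: powr_le1)
  qed (simp add: normal_factor_def)
  then show "0 < normal_factor q e" "normal_factor q e \<le> 1" "- ln (normal_factor q e) / real e \<ge> 0"
    by (simp_all add: divide_nonpos_nonneg)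
qed

text \<open>With \<open>d = ord e q\<close> and \<open>x = 1 / q ^ d\<close>, the exponent satisfies
  \<open>totient e / (e * d) \<le> 1\<close>, and \<open>x \<le> 1 / 2\<close> gives
  \<open>- ln (1 - x) \<le> 2 * x\<close>.\<close>

lemma neg_ln_normal_factor_le:
  assumes q: "q > 1" and cop: "coprime e q" and e: "e > 0"
  shows "- ln (normal_factor q e) / real e \<le> 2 / real q ^ ord e q"
proof -
  define d where "d = ord e q"
  define x where "x = 1 / real q ^ d"
  have d: "d > 0" using ord_properties(1)[OF cop e] by (simp add: d_def)
  have "real q \<le> real q ^ d" using q d by (intro self_le_power) auto
  then have "2 \<le> real q ^ d" using q by linarith
  then have x: "0 < x" "x \<le> 1 / 2"
    using divide_left_mono[of 2 "real q ^ d" 1] q by (simp_all add: x_def)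
  have "2 * x\<^sup>2 \<le> x" using mult_left_mono[OF x(2), of x] x by (simp add: power2_eq_square)
  then have ln: "- ln (1 - x) \<le> 2 * x" using ln_one_minus_pos_lower_bound[of x] x by simp
  have "real (totient e) \<le> real e" using totient_le[of e] by simp
  also have "\<dots> \<le> real e * real d" using d e by simp
  finally have c: "real (totient e) / (real e * real d) \<le> 1" using d e by simp
  have "- ln (normal_factor q e) / real e = real (totient e) / (real e * real d) * (- ln (1 - x))"
    using cop x by (simp add: normal_factor_def d_def[symmetric] x_def[symmetric] ln_powr)
  also have "\<dots> \<le> 1 * (2 * x)" by (rule mult_mono[OF c ln]) (use x in auto)
  finally show ?thesis by (simp add: x_def d_def)
qed

text \<open>
  The \<open>e\<close> with \<open>ord e q = d\<close> divide \<open>q ^ d - 1\<close>, so there are at most \<open>2 * q ^ (d / 2)\<close> of them: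
  this is why the contributions of the individual \<open>e\<close>, of size \<open>q ^ (- d)\<close>, are summable.
\<close>

lemma sum_neg_ln_normal_factor_le:
  assumes q: "q > 1"
  defines "s \<equiv> 1 / sqrt (real q)"
  shows "(\<Sum>e<N. - ln (normal_factor q e) / real e) \<le> 4 * (s / (1 - s))"
proof -
  define S where "S = {e. e < N \<and> coprime e q}"
  have fin: "finite S" by (simp add: S_def)
  have s: "0 < s" "s < 1" using q by (simp_all add: s_def)
  have pos: "e > 0" if "e \<in> S" for e using that q by (cases e) (auto simp: S_def)
  have S: "ord e q \<in> {1..N}" "e dvd q ^ ord e q - 1" if "e \<in> S" for e
    using ord_properties[of e q] pos[OF that] that by (auto simp: S_def Suc_le_eq)
  have "(\<Sum>e<N. - ln (normal_factor q e) / real e) = (\<Sum>e\<in>S. - ln (normal_factor q e) / real e)"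
    by (rule sum.mono_neutral_right) (auto simp: S_def normal_factor_def)
  also have "\<dots> \<le> (\<Sum>e\<in>S. 2 / real q ^ ord e q)"
    by (intro sum_mono neg_ln_normal_factor_le[OF q]) (use pos in \<open>auto simp: S_def\<close>)
  \<comment> \<open>Grouping by the order, which for \<open>e < N\<close> is at most
    \<open>N\<close>.\<close>
  also have "\<dots> = (\<Sum>d=1..N. \<Sum>e\<in>{e\<in>S. ord e q = d}. 2 / real q ^ ord e q)"
    by (rule sum.group[symmetric]) (use S fin in auto)
  also have "\<dots> \<le> (\<Sum>d=1..N. 4 * s ^ d)"
  proof (rule sum_mono)
    fix d assume "d \<in> {1..N}"
    then have "1 < q ^ d" using q by (intro one_less_power) auto
    then have m: "q ^ d - 1 > 0" by simp
    have "card {e\<in>S. ord e q = d} \<le> card {e. e dvd q ^ d - 1}"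
      by (rule card_mono) (use m S in auto)
    then have "real (card {e\<in>S. ord e q = d}) \<le> 2 * sqrt (real (q ^ d - 1))"
      using card_divisors_le_sqrt[OF m] by linarith
    also have "\<dots> \<le> 2 * sqrt (real q ^ d)" using of_nat_mono[of "q ^ d - 1" "q ^ d"] by simp
    finally have c: "real (card {e\<in>S. ord e q = d}) \<le> 2 * sqrt (real q) ^ d" by (simp add: real_sqrt_power)
    have "(\<Sum>e\<in>{e\<in>S. ord e q = d}. 2 / real q ^ ord e q)
        = real (card {e\<in>S. ord e q = d}) * (2 / real q ^ d)" by simp
    also have "\<dots> \<le> 2 * sqrt (real q) ^ d * (2 / real q ^ d)"
      by (rule mult_right_mono[OF c]) simp
    also have "\<dots> = 4 * (sqrt (real q) / real q) ^ d" by (simp add: power_divide)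
    \<comment> \<open>The at most \<open>2 * sqrt q ^ d\<close> terms of size
      \<open>2 / q ^ d\<close> leave a geometric series of ratio \<open>s\<close>.\<close>
    also have "sqrt (real q) / real q = s" using q by (simp add: s_def real_div_sqrt divide_simps)
    finally show "(\<Sum>e\<in>{e\<in>S. ord e q = d}. 2 / real q ^ ord e q) \<le> 4 * s ^ d" .
  qed
  also have "\<dots> = 4 * (\<Sum>d<N. s ^ Suc d)"
    by (simp add: sum_distrib_left[symmetric] sum.atLeast1_atMost_eq)
  also have "(\<Sum>d<N. s ^ Suc d) \<le> s / (1 - s)"
  proof -
    have sums: "(\<lambda>d. s ^ Suc d) sums (s * (1 / (1 - s)))"
      using sums_mult[OF geometric_sums[of s], of s] s by simp
    have "(\<Sum>d<N. s ^ Suc d) \<le> (\<Sum>d. s ^ Suc d)"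
      by (rule sum_le_suminf[OF sums_summable[OF sums]]) (use s in auto)
    then show ?thesis using sums_unique[OF sums] by simp
  qed
  finally show ?thesis by simp
qed

lemma summable_neg_ln_normal_factor:
  "q > 1 \<Longrightarrow> summable (\<lambda>e. - ln (normal_factor q e) / real e)"
  by (rule summableI_nonneg_bounded[OF neg_ln_normal_factor_nonneg sum_neg_ln_normal_factor_le])

lemma suminf_neg_ln_normal_factor_le:
  "q > 1 \<Longrightarrow> (\<Sum>e. - ln (normal_factor q e) / real e)
     \<le> 4 * ((1 / sqrt (real q)) / (1 - 1 / sqrt (real q)))"
  by (rule suminf_le_const[OF summable_neg_ln_normal_factor sum_neg_ln_normal_factor_le])

text \<open>Where \<open>normal_factor q e\<close> differs from 1, \<open>e\<close> is coprime to
  \<open>q\<close>, and so has an order through which it divides \<open>L_seq q t\<close>.\<close>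

lemma divisor_product_mean_normal_factor:
  assumes q: "q > 1"
  shows "divisor_product_mean (normal_factor q) (L_seq q)"
proof
  fix t e
  show "L_seq q t > 0"
  proof (rule ccontr)
    assume "\<not> L_seq q t > 0"
    then obtain i where "i \<in> {1..t}" "q ^ i - 1 = 0" unfolding L_seq_def by (auto simp: Lcm_0_iff)
    then show False using one_less_power[OF q, of i] by simp
  qed
  show "L_seq q t dvd L_seq q (Suc t)"
    unfolding L_seq_def by (rule Lcm_subset) auto
  assume e: "e > 0" "e \<le> t" "normal_factor q e \<noteq> 1"
  then have cop: "coprime e q" by (auto simp: normal_factor_def split: if_splits)
  have "e dvd q ^ ord e q - 1" by (rule ord_properties(3)[OF cop e(1)])
  also have "\<dots> dvd L_seq q t"
    unfolding L_seq_def using ord_properties(1,2)[OF cop e(1)] e(2) by (intro dvd_Lcm imageI) (simp add: Suc_le_eq)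
  finally show "e dvd L_seq q t" .
qed (rule normal_factor_pos[OF q] normal_factor_le_1[OF q] summable_neg_ln_normal_factor[OF q])+

section \<open>Transfer to \<open>A_seq\<close> and \<open>mean_density\<close>, and the limit in
  \<open>q\<close>\<close>

lemma mean_density_properties:
  assumes q: "primepow q"
  shows "A_seq q \<longlonglongrightarrow> mean_density q" (is ?conv)
    and "exp (- (4 * ((1 / sqrt (real q)) / (1 - 1 / sqrt (real q))))) \<le> mean_density q" (is ?lower)
    and "mean_density q \<le> 1" (is ?upper)
    and "((\<lambda>x::real. (1 / x) * (\<Sum>n | 1 \<le> n \<and> real n \<le> x. normal_density q n))
               \<longlongrightarrow> mean_density q) at_top" (is ?avg)
proof -
  have q1: "q > 1" using primepow_gt_Suc_0[OF q] by simp
  interpret divisor_product_mean "normal_factor q" "L_seq q"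
    by (rule divisor_product_mean_normal_factor[OF q1])
  \<comment> \<open>The equality is claimed for positive indices only, since the divisors of 0 form
    an infinite set; both sums below run over positive indices.\<close>
  have g: "normal_density q n = g n" if "n > 0" for n
    using normal_density_eq_prod[OF q that] by (simp add: g_def)
  have A: "A_seq q = A"
  proof
    fix t
    have "(\<Sum>r | r dvd L_seq q t. normal_density q r * real (totient (L_seq q t div r)))
        = (\<Sum>r | r dvd L_seq q t. g r * real (totient (L_seq q t div r)))"
      by (intro sum.cong refl) (use g dvd_pos_nat[OF L_pos] in auto)
    then show "A_seq q t = A t"
      unfolding A_seq_def A_def sum_gcd_eq_sum_divisors[OF L_pos] by simp
  qed
  have mean: "mean_density q = mean" by (simp add: mean_density_def mean_def A)
  show ?conv unfolding A mean by (rule A_tendsto)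
  show ?upper unfolding mean by (rule mean_le_1)
  \<comment> \<open>Being explicit in \<open>q\<close>, this bound yields positivity for each
    \<open>q\<close> and also the limit as \<open>q\<close> grows.\<close>
  show ?lower unfolding mean
    using mean_ge suminf_neg_ln_normal_factor_le[OF q1] by (meson exp_le_cancel_iff neg_le_iff_le order_trans)
  have "(\<Sum>n | 1 \<le> n \<and> real n \<le> x. normal_density q n) = (\<Sum>n | 1 \<le> n \<and> real n \<le> x. g n)" for x
    by (rule sum.cong) (use g in auto)
  then show ?avg unfolding mean using real_average_tendsto by simp
qed

theorem theorem4p2:
  shows "(\<forall>q::nat. primepow q \<longrightarrow>
            A_seq q \<longlonglongrightarrow> mean_density q \<and>
            mean_density q > 0 \<and>
            ((\<lambda>x::real. (1 / x) * (\<Sum>n | 1 \<le> n \<and> real n \<le> x. normal_density q n))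
               \<longlongrightarrow> mean_density q) at_top) \<and>
         (mean_density \<longlongrightarrow> 1) (inf at_top (principal {q. primepow q}))"
proof (intro conjI allI impI)
  fix q :: nat assume q: "primepow q"
  show "A_seq q \<longlonglongrightarrow> mean_density q" by (rule mean_density_properties(1)[OF q])
  show "mean_density q > 0" using mean_density_properties(2)[OF q] exp_gt_zero less_le_trans by blast
  show "((\<lambda>x::real. (1 / x) * (\<Sum>n | 1 \<le> n \<and> real n \<le> x. normal_density q n))
               \<longlongrightarrow> mean_density q) at_top"
    by (rule mean_density_properties(4)[OF q])
next
  \<comment> \<open>\<open>q\<close> tends to infinity through prime powers, where the bounds on
    \<open>mean_density\<close> are available.\<close>
  let ?F = "inf at_top (principal {q::nat. primepow q})"
  let ?l = "\<lambda>q::nat. exp (- (4 * ((1 / sqrt (real q)) / (1 - 1 / sqrt (real q)))))"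
  have "filterlim (\<lambda>q::nat. sqrt (real q)) at_top at_top"
    by (rule filterlim_compose[OF sqrt_at_top filterlim_real_sequentially])
  then have "((\<lambda>q::nat. 1 / sqrt (real q)) \<longlongrightarrow> 0) at_top"
    by (intro tendsto_divide_0[OF tendsto_const] filterlim_at_top_imp_at_infinity)
  \<comment> \<open>The lower bound is a function of \<open>1 / sqrt q\<close> that is continuous at
    0 with value 1 there.\<close>
  moreover have "isCont (\<lambda>x::real. exp (- (4 * (x / (1 - x))))) 0"
    by (intro continuous_intros) simp
  ultimately have "(?l \<longlongrightarrow> exp (- (4 * (0 / (1 - 0))))) at_top"
    by (intro isCont_tendsto_compose[of 0 "\<lambda>x::real. exp (- (4 * (x / (1 - x))))"])
  then have "(?l \<longlongrightarrow> 1) at_top" by simp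
  then have lim: "(?l \<longlongrightarrow> 1) ?F" by (rule tendsto_mono[OF inf_le1])
  have bounds: "\<forall>\<^sub>F q in ?F. ?l q \<le> mean_density q" "\<forall>\<^sub>F q in ?F. mean_density q \<le> 1"
    using mean_density_properties(2,3) by (simp_all add: eventually_inf_principal)
  show "(mean_density \<longlongrightarrow> 1) ?F" by (rule tendsto_sandwich[OF bounds lim tendsto_const])
qed

end
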